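(* Let $n\ge 1$ and $k\in\{1,\dots,n\}$. Let $\mathcal{G}$ denote the Grassmann manifold of all $k$-dimensional linear subspaces of $\mathbb{R}^n$ with its usual differential structure. Then the map \[ \varphi:\mathcal{G}\to\{Q\in \mathrm{O}(n): Q^{\mathsf T}=Q,\ \operatorname{tr}(Q)=2k-n\},\qquad \varphi(\mathbb{W})=P_{\mathbb{W}}-P_{\mathbb{W}^\perp}, \] is a diffeomorphism, with inverse $\varphi^{-1}(Q)=\operatorname{im}(Y_Q)$.
   Context: $\mathrm{O}(n)$ is the group of real $n\times n$ orthogonal matrices; the target set carries its smooth structure as an embedded submanifold of $\mathrm{O}(n)\subseteq\mathbb{R}^{n\times n}$. $P_{\mathbb{W}}$ denotes the orthogonal projection matrix onto $\mathbb{W}$. A matrix $Q$ in the target set is symmetric with eigenvalue $1$ of multiplicity $k$ and eigenvalue $-1$ of multiplicity $n-k$; $Y_Q\in\mathbb{R}^{n\times k}$ denotes any matrix whose columns form an orthonormal basis of the $1$-eigenspace of $Q$, so that $\operatorname{im}(Y_Q)$ is the $1$-eigenspace of $Q$. *)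

theory Defs
  imports "HOL-Analysis.Analysis"
begin

section \<open>Smooth maps between subsets of Euclidean spaces\<close>

text \<open>
  Differentiability of class \<open>C\<^sup>m\<close> on an \<^emph>\<open>open\<close> set of a Euclidean space, by iterating
  directional derivatives of the Frechet derivative.
\<close>

primrec Ck_on :: "nat \<Rightarrow> 'a::euclidean_space set \<Rightarrow> ('a \<Rightarrow> 'b::euclidean_space) \<Rightarrow> bool" where
  "Ck_on 0 S f \<longleftrightarrow> continuous_on S f"
| "Ck_on (Suc m) S f \<longleftrightarrow>
     (\<forall>x\<in>S. f differentiable (at x)) \<and>
     (\<forall>v. Ck_on m S (\<lambda>x. frechet_derivative f (at x) v))"

definition smooth_on :: "'a::euclidean_space set \<Rightarrow> ('a \<Rightarrow> 'b::euclidean_space) \<Rightarrow> bool" where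
  "smooth_on S f \<longleftrightarrow> (\<forall>m. Ck_on m S f)"

text \<open>
  Smoothness on an arbitrary subset: local extendability to a smooth function on an open set.
  It is only used for relatively open subsets of linear subspaces, where it is the usual
  notion of a smooth function on an open subset of a finite-dimensional vector space.
\<close>

definition smooth_map_on :: "'a::euclidean_space set \<Rightarrow> ('a \<Rightarrow> 'b::euclidean_space) \<Rightarrow> bool" where
  "smooth_map_on S f \<longleftrightarrow>
     (\<forall>x\<in>S. \<exists>T g. open T \<and> x \<in> T \<and> smooth_on T g \<and> (\<forall>y\<in>S \<inter> T. g y = f y))"


section \<open>Smooth manifolds\<close>

text \<open>
  A chart is a pair \<open>(U, \<phi>)\<close>; only the values of \<open>\<phi>\<close> on \<open>U\<close> matter. The model spaces are
  linear subspaces of dimension \<open>mdim M\<close> of a fixed Euclidean space (instead of one copy of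
  \<open>\<real>\<^sup>d\<close>), which may differ from chart to chart; this also covers dimension 0.
\<close>

type_synonym ('a, 'e) chart = "'a set \<times> ('a \<Rightarrow> 'e)"

record ('a, 'e) charted_space =
  mdim :: nat
  mtop :: "'a topology"
  matlas :: "('a, 'e) chart set"

abbreviation mcarrier :: "('a, 'e) charted_space \<Rightarrow> 'a set" where
  "mcarrier M \<equiv> topspace (mtop M)"

definition manifold_chart :: "('a, 'e::euclidean_space) charted_space \<Rightarrow> ('a, 'e) chart \<Rightarrow> bool" where
  "manifold_chart M = (\<lambda>(U, \<phi>).
     openin (mtop M) U \<and>
     (\<exists>L. subspace L \<and> dim L = mdim M \<and> openin (top_of_set L) (\<phi> ` U)) \<and>
     homeomorphic_map (subtopology (mtop M) U) (top_of_set (\<phi> ` U)) \<phi>)"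

definition smooth_manifold :: "('a, 'e::euclidean_space) charted_space \<Rightarrow> bool" where
  "smooth_manifold M \<longleftrightarrow>
     Hausdorff_space (mtop M) \<and> second_countable (mtop M) \<and>
     (\<forall>c\<in>matlas M. manifold_chart M c) \<and>
     (\<Union>(U, \<phi>)\<in>matlas M. U) = mcarrier M \<and>
     (\<forall>(U, \<phi>)\<in>matlas M. \<forall>(V, \<psi>)\<in>matlas M.
        smooth_map_on (\<phi> ` (U \<inter> V)) (\<psi> \<circ> inv_into U \<phi>))"

definition smooth_map ::
    "('a, 'e::euclidean_space) charted_space \<Rightarrow> ('b, 'f::euclidean_space) charted_space \<Rightarrow>
     ('a \<Rightarrow> 'b) \<Rightarrow> bool" where
  "smooth_map M N f \<longleftrightarrow>
     continuous_map (mtop M) (mtop N) f \<and>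
     (\<forall>(U, \<phi>)\<in>matlas M. \<forall>(V, \<psi>)\<in>matlas N.
        smooth_map_on (\<phi> ` (U \<inter> f -` V)) (\<psi> \<circ> f \<circ> inv_into U \<phi>))"

definition diffeomorphism ::
    "('a, 'e::euclidean_space) charted_space \<Rightarrow> ('b, 'f::euclidean_space) charted_space \<Rightarrow>
     ('a \<Rightarrow> 'b) \<Rightarrow> bool" where
  "diffeomorphism M N f \<longleftrightarrow>
     smooth_manifold M \<and> smooth_manifold N \<and>
     bij_betw f (mcarrier M) (mcarrier N) \<and>
     smooth_map M N f \<and> smooth_map N M (inv_into (mcarrier M) f)"

text \<open>
  A subset \<open>S\<close> of a Euclidean space with its subspace topology and all charts obtained by
  restricting \<open>d\<close>-dimensional slice charts, i.e. diffeomorphisms \<open>\<psi>\<close> between open sets \<open>A\<close> and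
  \<open>\<psi> ` A\<close> of the ambient space that carry \<open>S \<inter> A\<close> onto the part of \<open>\<psi> ` A\<close> lying in a
  linear subspace of dimension \<open>d\<close>. This is a \<open>smooth_manifold\<close> only if the slice charts cover
  \<open>S\<close>, i.e. only if \<open>S\<close> is an embedded \<open>d\<close>-dimensional submanifold.
\<close>

definition slice_charts :: "nat \<Rightarrow> 'a::euclidean_space set \<Rightarrow> ('a, 'a) chart set" where
  "slice_charts d S = {(S \<inter> A, \<psi>) | A \<psi>.
     open A \<and> open (\<psi> ` A) \<and> inj_on \<psi> A \<and>
     smooth_on A \<psi> \<and> smooth_on (\<psi> ` A) (inv_into A \<psi>) \<and>
     (\<exists>L. subspace L \<and> dim L = d \<and> \<psi> ` (S \<inter> A) = \<psi> ` A \<inter> L)}"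

definition embedded_submanifold :: "nat \<Rightarrow> 'a::euclidean_space set \<Rightarrow> ('a, 'a) charted_space" where
  "embedded_submanifold d S = \<lparr>mdim = d, mtop = top_of_set S, matlas = slice_charts d S\<rparr>"


section \<open>The Grassmann manifold\<close>

definition Grassmannian :: "nat \<Rightarrow> (real^'n) set set" where
  "Grassmannian k = {W. subspace W \<and> dim W = k}"

text \<open>
  The standard chart centred at \<open>W\<^sub>0\<close>: the subspaces \<open>W\<close> that meet the orthogonal complement of
  \<open>W\<^sub>0\<close> trivially are exactly the graphs of the linear maps from \<open>W\<^sub>0\<close> to that complement. Such a
  map is represented by the matrix that extends it by zero on the complement, so the model
  space is the corresponding \<open>k (n - k)\<close>-dimensional space of matrices.
\<close>

definition graph_domain :: "(real^'n) set \<Rightarrow> (real^'n) set set" where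
  "graph_domain W\<^sub>0 = {W \<in> Grassmannian (dim W\<^sub>0). W \<inter> orthogonal_comp W\<^sub>0 = {0}}"

definition graph_coord :: "(real^'n) set \<Rightarrow> (real^'n) set \<Rightarrow> real^'n^'n" where
  "graph_coord W\<^sub>0 W = (THE A.
     (\<forall>x\<in>W\<^sub>0. A *v x \<in> orthogonal_comp W\<^sub>0) \<and>
     (\<forall>x\<in>orthogonal_comp W\<^sub>0. A *v x = 0) \<and>
     W = {x + A *v x | x. x \<in> W\<^sub>0})"

definition Grassmann_charts :: "nat \<Rightarrow> ((real^'n) set, real^'n^'n) chart set" where
  "Grassmann_charts k = {(graph_domain W\<^sub>0, graph_coord W\<^sub>0) | W\<^sub>0. W\<^sub>0 \<in> Grassmannian k}"

definition Grassmann_topology :: "nat \<Rightarrow> (real^'n) set topology" where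
  "Grassmann_topology k = topology_generated_by
     {U \<inter> \<phi> -` B | U \<phi> B. (U, \<phi>) \<in> Grassmann_charts k \<and> open B}"

definition Grassmann_manifold :: "nat \<Rightarrow> ((real^'n) set, real^'n^'n) charted_space" where
  "Grassmann_manifold k =
     \<lparr>mdim = k * (CARD('n) - k), mtop = Grassmann_topology k, matlas = Grassmann_charts k\<rparr>"


section \<open>The matrix model\<close>

definition proj_matrix :: "(real^'n) set \<Rightarrow> real^'n^'n" where
  "proj_matrix W = (THE P. \<forall>x. P *v x \<in> W \<and> x - P *v x \<in> orthogonal_comp W)"

definition reflection_model :: "nat \<Rightarrow> (real^'n^'n) set" where
  "reflection_model k =
     {Q. orthogonal_matrix Q \<and> transpose Q = Q \<and> trace Q = 2 * real k - real CARD('n)}"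

definition grassmann_reflection :: "(real^'n) set \<Rightarrow> real^'n^'n" where
  "grassmann_reflection W = proj_matrix W - proj_matrix (orthogonal_comp W)"

text \<open>The columns of \<open>Y\<close> form an orthonormal basis of the eigenspace of \<open>Q\<close> for the eigenvalue 1.\<close>

definition eigenbasis_matrix :: "real^'n^'n \<Rightarrow> real^'k^'n \<Rightarrow> bool" where
  "eigenbasis_matrix Q Y \<longleftrightarrow>
     (\<forall>i j. column i Y \<bullet> column j Y = (if i = j then 1 else 0)) \<and>
     span (columns Y) = {x. Q *v x = x}"

end

theory Submission
  imports Defs
begin

text \<open>
  Write \<open>Q = 2 P - 1\<close>, so that the matrix model becomes the set of orthogonal projections of
  rank \<open>k\<close>. Fix a subspace \<open>W\<close> with projection \<open>P\<close>. The coordinate \<open>X : W \<rightarrow> W\<^sup>\<bottom>\<close> of a subspace in the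
  chart centred at \<open>W\<close> is the rational function
  \<open>X = (1 - P) M P (P M P + 1 - P)\<^sup>-\<^sup>1\<close> of its projection \<open>M\<close>, and \<open>M\<close> is recovered as
  \<open>\<sigma>(X) = (P + X) (1 + X\<^sup>T X)\<^sup>-\<^sup>1 (P + X\<^sup>T)\<close>; both formulas are smooth on open sets of matrices, so the
  Grassmannian carries the topology and the charts pulled back from the matrix model.

  An explicit slice chart avoids the inverse function theorem: since \<open>X\<^sup>2 = 0\<close>, the matrix
  \<open>1 + X\<close> has inverse \<open>1 - X\<close>, and \<open>(1 - X) M\<close> has zero lower left block. Hence
  \<open>M \<mapsto> X + (1 - X) (M - \<sigma>(X))\<close> has \<open>X\<close> as its lower left block, is inverted by
  \<open>Z \<mapsto> \<sigma>(X) + (1 + X) (Z - X)\<close>, and maps exactly the projections of rank \<open>k\<close> into the space of the \<open>X\<close>.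
\<close>

section \<open>Calculus of smooth maps\<close>

text \<open>The Frechet derivative at a point depends only on nearby values, and \<open>S\<close> is
  open. So \<open>g\<close> has the derivatives of \<open>f\<close> on \<open>S\<close>, and the
  induction continues with the directional derivatives.\<close>

lemma Ck_on_cong:
  assumes "open S" "\<And>x. x \<in> S \<Longrightarrow> f x = g x" "Ck_on m S f"
  shows "Ck_on m S g"
  using assms(2,3)
proof (induction m arbitrary: f g)
  case 0
  then show ?case by (simp cong: continuous_on_cong)
next
  case (Suc m)
  have d: "f differentiable (at x)" if "x \<in> S" for x
    using Suc.prems(2) that by simp
  then have D: "(g has_derivative frechet_derivative f (at x)) (at x)" if "x \<in> S" for x
    using that Suc.prems(1) frechet_derivative_works
    by (blast intro: has_derivative_transform_within_open[OF _ assms(1)])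
  then have eq: "frechet_derivative f (at x) = frechet_derivative g (at x)" if "x \<in> S" for x
    using that frechet_derivative_at by blast
  show ?case
    unfolding Ck_on.simps
  proof (intro conjI ballI allI)
    show "g differentiable (at x)" if "x \<in> S" for x
      using D that differentiable_def by blast
    show "Ck_on m S (\<lambda>x. frechet_derivative g (at x) v)" for v
    proof (rule Suc.IH)
      show "Ck_on m S (\<lambda>x. frechet_derivative f (at x) v)" using Suc.prems(2) by simp
    qed (simp add: eq)
  qed
qed

text \<open>Derivatives are unique, so an explicit formula \<open>D\<close> may replace the chosen
  \<open>frechet_derivative\<close> of the definition.\<close>

lemma Ck_on_SucI:
  assumes "open S" "\<And>x. x \<in> S \<Longrightarrow> (f has_derivative D x) (at x)"
    and "\<And>v. Ck_on m S (\<lambda>x. D x v)"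
  shows "Ck_on (Suc m) S f"
  unfolding Ck_on.simps
proof (intro conjI ballI allI)
  show "f differentiable (at x)" if "x \<in> S" for x
    using assms(2) that differentiable_def by blast
  show "Ck_on m S (\<lambda>x. frechet_derivative f (at x) v)" for v
    by (intro Ck_on_cong[OF assms(1) _ assms(3)[of v]]) (simp add: frechet_derivative_at[symmetric, OF assms(2)])
qed

lemma Ck_on_Suc_has_derivative:
  "Ck_on (Suc m) S f \<Longrightarrow> x \<in> S \<Longrightarrow> (f has_derivative frechet_derivative f (at x)) (at x)"
  by (simp add: frechet_derivative_works)

lemma Ck_on_Suc_derivative:
  "Ck_on (Suc m) S f \<Longrightarrow> Ck_on m S (\<lambda>x. frechet_derivative f (at x) v)"
  by simp

lemma Ck_on_SucD: "Ck_on (Suc m) S f \<Longrightarrow> Ck_on m S f"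
proof (induction m arbitrary: f)
  case 0
  then show ?case
    by (auto intro!: continuous_at_imp_continuous_on differentiable_imp_continuous_within)
next
  case (Suc m)
  then show ?case
    by (metis Ck_on.simps(2))
qed

lemma Ck_on_subset: "Ck_on m S f \<Longrightarrow> T \<subseteq> S \<Longrightarrow> Ck_on m T f"
  by (induction m arbitrary: f) (auto intro: continuous_on_subset)

lemma Ck_on_const: "open S \<Longrightarrow> Ck_on m S (\<lambda>x. c)"
proof (induction m arbitrary: c)
  case (Suc m)
  then show ?case by (intro Ck_on_SucI[where D = "\<lambda>x v. 0"]) auto
qed simp

lemma Ck_on_bounded_linear:
  assumes "bounded_linear L" "open S" "Ck_on m S f"
  shows "Ck_on m S (\<lambda>x. L (f x))"
  using assms(3)
proof (induction m arbitrary: f)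
  case 0
  then show ?case by (simp add: assms(1) linear_continuous_on_compose bounded_linear.continuous_on)
next
  case (Suc m)
  show ?case
    by (rule Ck_on_SucI[OF assms(2), where D = "\<lambda>x v. L (frechet_derivative f (at x) v)"])
      (use Suc in \<open>auto intro!: bounded_linear.has_derivative[OF assms(1)] Ck_on_Suc_has_derivative\<close>)
qed

lemma Ck_on_add:
  assumes "open S" "Ck_on m S f" "Ck_on m S g"
  shows "Ck_on m S (\<lambda>x. f x + g x)"
  using assms(2,3)
proof (induction m arbitrary: f g)
  case 0
  then show ?case by (simp add: continuous_on_add)
next
  case (Suc m)
  show ?case
    by (rule Ck_on_SucI[OF assms(1),
          where D = "\<lambda>x v. frechet_derivative f (at x) v + frechet_derivative g (at x) v"])
      (use Suc in \<open>auto intro!: has_derivative_add Ck_on_Suc_has_derivative\<close>)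
qed

lemma Ck_on_sum:
  assumes "open S" "\<And>i. i \<in> I \<Longrightarrow> Ck_on m S (f i)"
  shows "Ck_on m S (\<lambda>x. \<Sum>i\<in>I. f i x)"
  using assms(2)
  by (induction I rule: infinite_finite_induct) (auto intro: Ck_on_const Ck_on_add assms(1))

text \<open>The product rule gives two terms of the same bilinear shape, one with f' and one with
  g'. The induction hypothesis covers both, being general in \<open>f\<close> and \<open>g\<close>;
  the undifferentiated factor drops by one class.\<close>

lemma Ck_on_bilinear:
  assumes "bounded_bilinear B" "open S" "Ck_on m S f" "Ck_on m S g"
  shows "Ck_on m S (\<lambda>x. B (f x) (g x))"
  using assms(3,4)
proof (induction m arbitrary: f g)
  case 0
  then show ?case by (simp add: bounded_bilinear.continuous_on[OF assms(1)])
next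
  case (Suc m)
  show ?case
  proof (rule Ck_on_SucI[OF assms(2)])
    show "((\<lambda>x. B (f x) (g x)) has_derivative
        (\<lambda>v. B (f x) (frechet_derivative g (at x) v) + B (frechet_derivative f (at x) v) (g x))) (at x)"
      if "x \<in> S" for x
      using that Suc.prems
      by (intro bounded_bilinear.FDERIV[OF assms(1)] Ck_on_Suc_has_derivative)
    show "Ck_on m S (\<lambda>x. B (f x) (frechet_derivative g (at x) v) + B (frechet_derivative f (at x) v) (g x))"
      for v
      using Suc.prems
      by (intro Ck_on_add[OF assms(2)] Suc.IH Ck_on_Suc_derivative) (auto intro: Ck_on_SucD)
  qed
qed

lemma Ck_on_ident: "open S \<Longrightarrow> Ck_on m S (\<lambda>x. x)"
proof (cases m)
  case (Suc k)
  then show "open S \<Longrightarrow> Ck_on m S (\<lambda>x. x)"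
    by (auto intro!: Ck_on_SucI[where D = "\<lambda>x v. v"] Ck_on_const has_derivative_ident)
qed (simp add: continuous_on_id)

text \<open>The chain rule yields g'(f x) in the direction f'(x) v, which varies with x, whereas
  \<open>Ck_on\<close> controls g' only in fixed directions. Expanding the direction in the basis
  leaves scalar factors of class m times g'(f x) b, and the latter are covered by the induction
  hypothesis.\<close>

lemma Ck_on_compose:
  assumes "open S" "open T" "f ` S \<subseteq> T" "Ck_on m S f" "Ck_on m T g"
  shows "Ck_on m S (\<lambda>x. g (f x))"
  using assms(4,5)
proof (induction m arbitrary: g)
  case 0
  then show ?case using assms(3) by (auto intro: continuous_on_compose2)
next
  case (Suc m)
  let ?f' = "\<lambda>x. frechet_derivative f (at x)" and ?g' = "\<lambda>y. frechet_derivative g (at y)"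
  show ?case
  proof (rule Ck_on_SucI[OF assms(1)])
    show "((\<lambda>x. g (f x)) has_derivative
        (\<lambda>v. \<Sum>b\<in>Basis. (?f' x v \<bullet> b) *\<^sub>R ?g' (f x) b)) (at x)" if "x \<in> S" for x
    proof -
      have g: "(g has_derivative ?g' (f x)) (at (f x))"
        using Suc.prems(2) that assms(3) by (intro Ck_on_Suc_has_derivative) auto
      then have lin: "linear (?g' (f x))"
        by (simp add: has_derivative_linear)
      have eq: "?g' (f x) w = (\<Sum>b\<in>Basis. (w \<bullet> b) *\<^sub>R ?g' (f x) b)" for w
        using linear_sum[OF lin, of "\<lambda>b. (w \<bullet> b) *\<^sub>R b" Basis]
        unfolding linear_scale[OF lin] euclidean_representation .
      show ?thesis
        using has_derivative_compose[OF Ck_on_Suc_has_derivative[OF Suc.prems(1) that] g]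
        unfolding eq[of "?f' x _"] .
    qed
    have "Ck_on m S (\<lambda>x. ?g' (f x) b)" for b
      by (rule Suc.IH[OF Ck_on_SucD[OF Suc.prems(1)] Ck_on_Suc_derivative[OF Suc.prems(2)]])
    then show "Ck_on m S (\<lambda>x. \<Sum>b\<in>Basis. (?f' x v \<bullet> b) *\<^sub>R ?g' (f x) b)" for v
      using Suc.prems(1)
      by (intro Ck_on_sum[OF assms(1)] Ck_on_bilinear[OF bounded_bilinear_scaleR assms(1)]
          Ck_on_bounded_linear[OF bounded_linear_inner_left assms(1)] Ck_on_Suc_derivative)
  qed
qed

text \<open>The derivative -(1/f) f' (1/f) involves only 1/f, covered by the induction hypothesis,
  and f', which is of class m.\<close>

lemma Ck_on_inverse:
  fixes f :: "'a::euclidean_space \<Rightarrow> real"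
  assumes "open S" "Ck_on m S f" "\<And>x. x \<in> S \<Longrightarrow> f x \<noteq> 0"
  shows "Ck_on m S (\<lambda>x. inverse (f x))"
  using assms(2)
proof (induction m)
  case 0
  then show ?case using assms(3) by (simp add: continuous_on_inverse)
next
  case (Suc m)
  show ?case
  proof (rule Ck_on_SucI[OF assms(1)])
    show "((\<lambda>x. inverse (f x)) has_derivative
        (\<lambda>v. - (inverse (f x) * frechet_derivative f (at x) v * inverse (f x)))) (at x)"
      if "x \<in> S" for x
      using that Suc.prems assms(3) by (intro Deriv.has_derivative_inverse Ck_on_Suc_has_derivative)
    show "Ck_on m S (\<lambda>x. - (inverse (f x) * frechet_derivative f (at x) v * inverse (f x)))" for v
      by (intro Ck_on_bounded_linear[OF bounded_linear_minus[OF bounded_linear_ident] assms(1)]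
          Ck_on_bilinear[OF bounded_bilinear_mult assms(1)] Suc.IH Ck_on_SucD[OF Suc.prems]
          Ck_on_Suc_derivative[OF Suc.prems])
  qed
qed

section \<open>Smooth maps into scalars, vectors and matrices\<close>

lemma smooth_on_cong:
  "open S \<Longrightarrow> smooth_on S f \<Longrightarrow> (\<And>x. x \<in> S \<Longrightarrow> f x = g x) \<Longrightarrow> smooth_on S g"
  unfolding smooth_on_def using Ck_on_cong by blast

lemma smooth_on_subset: "smooth_on S f \<Longrightarrow> T \<subseteq> S \<Longrightarrow> smooth_on T f"
  unfolding smooth_on_def using Ck_on_subset by blast

lemma smooth_on_const [simp]: "open S \<Longrightarrow> smooth_on S (\<lambda>x. c)"
  unfolding smooth_on_def by (simp add: Ck_on_const)

lemma smooth_on_ident [simp]: "open S \<Longrightarrow> smooth_on S (\<lambda>x. x)"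
  unfolding smooth_on_def by (simp add: Ck_on_ident)

lemma smooth_on_bounded_linear:
  "bounded_linear L \<Longrightarrow> open S \<Longrightarrow> smooth_on S f \<Longrightarrow> smooth_on S (\<lambda>x. L (f x))"
  unfolding smooth_on_def by (simp add: Ck_on_bounded_linear)

lemma smooth_on_add:
  "open S \<Longrightarrow> smooth_on S f \<Longrightarrow> smooth_on S g \<Longrightarrow> smooth_on S (\<lambda>x. f x + g x)"
  unfolding smooth_on_def by (simp add: Ck_on_add)

lemma smooth_on_scaleR:
  "open S \<Longrightarrow> smooth_on S f \<Longrightarrow> smooth_on S (\<lambda>x. c *\<^sub>R f x)"
  by (rule smooth_on_bounded_linear[OF bounded_linear_scaleR_right])

lemma smooth_on_diff:
  "open S \<Longrightarrow> smooth_on S f \<Longrightarrow> smooth_on S g \<Longrightarrow> smooth_on S (\<lambda>x. f x - g x)"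
  using smooth_on_add[of S f "\<lambda>x. (-1) *\<^sub>R g x"] smooth_on_scaleR[of S g "-1"] by simp

lemma smooth_on_sum:
  "open S \<Longrightarrow> (\<And>i. i \<in> I \<Longrightarrow> smooth_on S (f i)) \<Longrightarrow> smooth_on S (\<lambda>x. \<Sum>i\<in>I. f i x)"
  unfolding smooth_on_def by (simp add: Ck_on_sum)

lemma smooth_on_bilinear:
  "bounded_bilinear B \<Longrightarrow> open S \<Longrightarrow> smooth_on S f \<Longrightarrow> smooth_on S g \<Longrightarrow>
    smooth_on S (\<lambda>x. B (f x) (g x))"
  unfolding smooth_on_def by (simp add: Ck_on_bilinear)

lemma smooth_on_compose:
  "open S \<Longrightarrow> open T \<Longrightarrow> f ` S \<subseteq> T \<Longrightarrow> smooth_on S f \<Longrightarrow> smooth_on T g \<Longrightarrow>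
    smooth_on S (\<lambda>x. g (f x))"
  unfolding smooth_on_def using Ck_on_compose by blast

lemma smooth_on_inverse:
  fixes f :: "'a::euclidean_space \<Rightarrow> real"
  shows "open S \<Longrightarrow> smooth_on S f \<Longrightarrow> (\<And>x. x \<in> S \<Longrightarrow> f x \<noteq> 0) \<Longrightarrow>
    smooth_on S (\<lambda>x. inverse (f x))"
  unfolding smooth_on_def by (simp add: Ck_on_inverse)

lemma smooth_on_prod:
  fixes f :: "'i \<Rightarrow> 'a::euclidean_space \<Rightarrow> real"
  assumes "open S" "\<And>i. i \<in> I \<Longrightarrow> smooth_on S (f i)"
  shows "smooth_on S (\<lambda>x. \<Prod>i\<in>I. f i x)"
  using assms(2)
  by (induction I rule: infinite_finite_induct)
    (auto intro!: smooth_on_bilinear[OF bounded_bilinear_mult] assms(1) simp: assms(1))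

lemma smooth_on_imp_continuous_on: "smooth_on S f \<Longrightarrow> continuous_on S f"
  unfolding smooth_on_def by (metis Ck_on.simps(1))

lemma bounded_bilinear_matrix_mult:
  "bounded_bilinear ((**) :: real^'m^'n \<Rightarrow> real^'l^'m \<Rightarrow> real^'l^'n)"
  unfolding bilinear_conv_bounded_bilinear[symmetric] bilinear_def
  by (intro conjI allI linearI)
    (simp_all add: matrix_matrix_mult_def vec_eq_iff algebra_simps sum.distrib sum_distrib_left)

lemmas smooth_on_matrix_mult = smooth_on_bilinear[OF bounded_bilinear_matrix_mult]

lemma linear_transpose: "linear (transpose :: real^'n^'m \<Rightarrow> real^'m^'n)"
  by (rule linearI) (simp_all add: transpose_def vec_eq_iff)

lemma smooth_on_transpose:
  fixes f :: "'a::euclidean_space \<Rightarrow> real^'n^'m"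
  shows "open S \<Longrightarrow> smooth_on S f \<Longrightarrow> smooth_on S (\<lambda>x. transpose (f x))"
  by (rule smooth_on_bounded_linear) (use linear_transpose linear_conv_bounded_linear in auto)

text \<open>A vector is the finite sum of its components, each put in place by the linear map
  \<open>axis i\<close>.\<close>

lemma smooth_on_vec:
  fixes f :: "'a::euclidean_space \<Rightarrow> 'b::euclidean_space^'n"
  assumes "open S" "\<And>i. smooth_on S (\<lambda>x. f x $ i)"
  shows "smooth_on S f"
proof -
  have "linear (axis i :: 'b \<Rightarrow> 'b^'n)" for i
    by (rule linearI) (auto simp: axis_def vec_eq_iff)
  then have "smooth_on S (\<lambda>x. \<Sum>i\<in>UNIV. axis i (f x $ i))"
    using assms by (intro smooth_on_sum smooth_on_bounded_linear[of "axis _"])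
      (auto simp: linear_conv_bounded_linear)
  moreover have "(\<Sum>i\<in>UNIV. axis i (f x $ i)) = f x" for x
    by (simp add: vec_eq_iff axis_def if_distrib cong: if_cong)
  ultimately show ?thesis by simp
qed

lemma smooth_on_vec_nth:
  fixes f :: "'a::euclidean_space \<Rightarrow> 'b::euclidean_space^'n"
  shows "open S \<Longrightarrow> smooth_on S f \<Longrightarrow> smooth_on S (\<lambda>x. f x $ i)"
  by (rule smooth_on_bounded_linear[OF bounded_linear_vec_nth])

lemma smooth_on_det:
  fixes f :: "'a::euclidean_space \<Rightarrow> real^'n^'n"
  assumes "open S" "smooth_on S f"
  shows "smooth_on S (\<lambda>x. det (f x))"
  unfolding det_def
  by (intro smooth_on_sum smooth_on_bilinear[OF bounded_bilinear_mult] smooth_on_prod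
      smooth_on_const smooth_on_vec_nth assms)

lemma
  fixes A :: "real^'n^'n"
  assumes "invertible A"
  shows matrix_inv_right: "A ** matrix_inv A = mat 1"
    and matrix_inv_left: "matrix_inv A ** A = mat 1"
  using someI_ex[OF assms[unfolded invertible_def]] by (auto simp: matrix_inv_def)

text \<open>Cramer's rule for A y = e_j, whose solution is the \<open>j\<close>-th column of the
  inverse. The entries become rational functions of those of \<open>A\<close>, so inversion is
  smooth without being differentiated.\<close>

lemma matrix_inv_cramer:
  fixes A :: "real^'n^'n"
  assumes "invertible A"
  shows "matrix_inv A $ k $ j =
    inverse (det A) * det (\<chi> i l. if l = k then axis j 1 $ i else A $ i $ l)"
proof -
  have "A *v (matrix_inv A *v axis j 1) = axis j 1"
    by (simp add: matrix_vector_mul_assoc matrix_inv_right[OF assms])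
  then have "matrix_inv A *v axis j 1 =
      (\<chi> k. det (\<chi> i l. if l = k then axis j 1 $ i else A $ i $ l) / det A)"
    using assms cramer invertible_det_nz by blast
  then have "(matrix_inv A *v axis j 1) $ k =
      det (\<chi> i l. if l = k then axis j 1 $ i else A $ i $ l) / det A" by simp
  then show ?thesis
    by (simp add: matrix_vector_mul_component inner_axis' divide_inverse mult.commute
        matrix_vector_mult_basis column_def)
qed

lemma smooth_on_matrix_inv:
  fixes f :: "'a::euclidean_space \<Rightarrow> real^'n^'n"
  assumes "open S" "smooth_on S f" "\<And>x. x \<in> S \<Longrightarrow> invertible (f x)"
  shows "smooth_on S (\<lambda>x. matrix_inv (f x))"
proof -
  \<comment> \<open>An entry of the Cramer matrix is a constant in the replaced column and an entry
    of \<open>f x\<close> elsewhere; \<open>P\<close> stands for the test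
    \<open>l = k\<close>.\<close>
  have e: "smooth_on S (\<lambda>x. if P then c else f x $ i $ j)" for P c i j
    by (cases P) (auto intro!: smooth_on_vec_nth smooth_on_const assms)
  have "smooth_on S (\<lambda>x. inverse (det (f x)) *
      det (\<chi> i l. if l = k then axis j 1 $ i else f x $ i $ l))" for k j
    using assms(3)
    by (intro smooth_on_bilinear[OF bounded_bilinear_mult] smooth_on_inverse smooth_on_det
        smooth_on_vec assms) (auto simp: e invertible_det_nz assms)
  then have "smooth_on S (\<lambda>x. matrix_inv (f x) $ k $ j)" for k j
    by (rule smooth_on_cong[OF assms(1)]) (rule matrix_inv_cramer[OF assms(3), symmetric])
  then show ?thesis
    by (intro smooth_on_vec assms)
qed

lemma open_invertible: "open {A :: real^'n^'n. invertible A}"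
proof -
  have "continuous_on UNIV (det :: real^'n^'n \<Rightarrow> real)"
    using smooth_on_imp_continuous_on[OF smooth_on_det] smooth_on_ident by auto
  then show ?thesis
    unfolding invertible_det_nz by (rule open_Collect_neq) simp
qed


section \<open>Orthogonal projections\<close>

lemmas matrix_add_rdistrib = bounded_bilinear.add_left[OF bounded_bilinear_matrix_mult]
lemmas matrix_diff_ldistrib = bounded_bilinear.diff_right[OF bounded_bilinear_matrix_mult]
lemmas matrix_diff_rdistrib = bounded_bilinear.diff_left[OF bounded_bilinear_matrix_mult]
lemmas matrix_scaleR_left = bounded_bilinear.scaleR_left[OF bounded_bilinear_matrix_mult]
lemmas matrix_scaleR_right = bounded_bilinear.scaleR_right[OF bounded_bilinear_matrix_mult]
lemmas matrix_zero_left = bounded_bilinear.zero_left[OF bounded_bilinear_matrix_mult]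
lemmas matrix_zero_right = bounded_bilinear.zero_right[OF bounded_bilinear_matrix_mult]

lemmas matrix_ring_simps = matrix_add_ldistrib matrix_add_rdistrib matrix_diff_ldistrib
  matrix_diff_rdistrib matrix_scaleR_left matrix_scaleR_right matrix_zero_left matrix_zero_right
  matrix_mul_assoc[symmetric]

lemmas transpose_add = linear_add[OF linear_transpose]
lemmas transpose_diff = linear_diff[OF linear_transpose]
lemmas transpose_zero = linear_0[OF linear_transpose]
lemmas transpose_sum = linear_sum[OF linear_transpose]

lemma inner_matrix_vector_transpose:
  fixes A :: "real^'n^'m"
  shows "x \<bullet> (A *v y) = (transpose A *v x) \<bullet> y"
  by (simp only: transpose_matrix_vector dot_lmul_matrix)

lemma orthogonal_comp_iff: "x \<in> orthogonal_comp W \<longleftrightarrow> (\<forall>y\<in>W. y \<bullet> x = 0)"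
  by (auto simp: orthogonal_comp_def orthogonal_def)

lemma orthogonal_comp_Int_eq_0: "x \<in> W \<Longrightarrow> x \<in> orthogonal_comp W \<Longrightarrow> x = 0"
  by (auto simp: orthogonal_comp_iff)

definition outer :: "real^'m \<Rightarrow> real^'n \<Rightarrow> real^'n^'m" where
  "outer u v = (\<chi> i j. u $ i * v $ j)"

lemma outer_mult_vec: "outer u v *v x = (v \<bullet> x) *\<^sub>R u"
  by (simp add: outer_def matrix_vector_mult_def vec_eq_iff inner_vec_def sum_distrib_left
      sum_distrib_right mult_ac)

lemma transpose_outer: "transpose (outer u v) = outer v u"
  by (simp add: outer_def transpose_def vec_eq_iff)

lemma trace_outer: "trace (outer u v) = u \<bullet> v"
  by (simp add: outer_def trace_def inner_vec_def)

lemma inner_outer: "outer u v \<bullet> outer u' v' = (u \<bullet> u') * (v \<bullet> v')"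
  unfolding inner_vec_def outer_def sum_product by (simp add: mult_ac)

lemma sum_matrix_vector_mult: "(\<Sum>i\<in>I. A i) *v x = (\<Sum>i\<in>I. A i *v x)"
  for A :: "'i \<Rightarrow> real^'n^'m"
  by (induction I rule: infinite_finite_induct) (simp_all add: matrix_vector_mult_add_rdistrib)

lemma orthonormal_basis:
  fixes W :: "'a::euclidean_space set"
  assumes "subspace W"
  obtains B where "finite B" "card B = dim W" "span B = W"
    "\<And>b c. b \<in> B \<Longrightarrow> c \<in> B \<Longrightarrow> b \<bullet> c = (if b = c then 1 else 0)"
proof -
  obtain B where B: "B \<subseteq> W" "pairwise orthogonal B" "\<And>x. x \<in> B \<Longrightarrow> norm x = 1"
    "independent B" "card B = dim W" "span B = W"
    using orthonormal_basis_subspace[OF assms] by metis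
  show ?thesis
  proof (rule that[of B])
    show "finite B" using B(4) independent_imp_finite by blast
    show "b \<bullet> c = (if b = c then 1 else 0)" if "b \<in> B" "c \<in> B" for b c
      using B(2,3) that by (auto simp: pairwise_def orthogonal_def norm_eq_1)
  qed (use B in auto)
qed

section \<open>The projection matrix of a subspace\<close>

text \<open>The values of two candidates at a vector differ by an element of both \<open>W\<close>
  and its complement, hence by 0.\<close>

lemma proj_matrix_unique:
  assumes "subspace W" "\<And>x. P *v x \<in> W" "\<And>x. x - P *v x \<in> orthogonal_comp W"
  shows "proj_matrix W = P"
  unfolding proj_matrix_def
proof (rule the_equality)
  show "\<forall>x. P *v x \<in> W \<and> x - P *v x \<in> orthogonal_comp W" using assms by blast
next
  fix R assume R: "\<forall>x. R *v x \<in> W \<and> x - R *v x \<in> orthogonal_comp W"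
  show "R = P"
    unfolding matrix_eq
  proof
    fix x
    have "R *v x - P *v x \<in> W"
      using R assms by (simp add: subspace_diff)
    moreover have "(x - P *v x) - (x - R *v x) \<in> orthogonal_comp W"
      using R assms subspace_diff[OF subspace_orthogonal_comp] by blast
    ultimately show "R *v x = P *v x"
      using orthogonal_comp_Int_eq_0[of "R *v x - P *v x" W] by simp
  qed
qed

text \<open>The sum of the b b^T maps \<open>x\<close> to its expansion in the orthonormal set
  \<open>B\<close>. The residual is orthogonal to each element of \<open>B\<close>, and this linear
  condition passes to the span.\<close>

lemma
  assumes "finite B" "\<And>b c. b \<in> B \<Longrightarrow> c \<in> B \<Longrightarrow> b \<bullet> c = (if b = c then 1 else 0)"
  shows sum_outer_in_span: "(\<Sum>b\<in>B. outer b b) *v x \<in> span B"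
    and sum_outer_diff_in: "x - (\<Sum>b\<in>B. outer b b) *v x \<in> orthogonal_comp (span B)"
proof -
  let ?P = "\<Sum>b\<in>B. outer b b"
  have P: "?P *v x = (\<Sum>b\<in>B. (b \<bullet> x) *\<^sub>R b)"
    by (simp add: sum_matrix_vector_mult outer_mult_vec)
  show "?P *v x \<in> span B"
    unfolding P by (intro span_sum span_scale span_base)
  have "c \<bullet> (x - ?P *v x) = 0" if "c \<in> B" for c
  proof -
    have "c \<bullet> (?P *v x) = (\<Sum>b\<in>B. if b = c then c \<bullet> x else 0)"
      unfolding P inner_sum_right by (rule sum.cong) (auto simp: assms(2)[OF that])
    then show ?thesis
      using assms(1) that by (simp add: inner_diff_right)
  qed
  then have "B \<subseteq> {y. y \<bullet> (x - ?P *v x) = 0}" by auto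
  moreover have "subspace {y. y \<bullet> (x - ?P *v x) = 0}"
    by (auto simp: subspace_def inner_add_left)
  ultimately have "span B \<subseteq> {y. y \<bullet> (x - ?P *v x) = 0}"
    by (rule span_minimal)
  then show "x - ?P *v x \<in> orthogonal_comp (span B)"
    by (auto simp: orthogonal_comp_iff)
qed

text \<open>Everything is read off the representation as a sum of b b^T over an orthonormal basis of
  \<open>W\<close>; each summand is symmetric of trace |b|^2 = 1.\<close>

lemma
  assumes "subspace W"
  shows proj_matrix_in: "proj_matrix W *v x \<in> W"
    and proj_matrix_diff_in: "x - proj_matrix W *v x \<in> orthogonal_comp W"
    and transpose_proj_matrix: "transpose (proj_matrix W) = proj_matrix W"
    and trace_proj_matrix: "trace (proj_matrix W) = real (dim W)"
proof -
  obtain B where B: "finite B" "card B = dim W" "span B = W"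
    "\<And>b c. b \<in> B \<Longrightarrow> c \<in> B \<Longrightarrow> b \<bullet> c = (if b = c then 1 else 0)"
    using orthonormal_basis[OF assms] by metis
  have P: "proj_matrix W = (\<Sum>b\<in>B. outer b b)"
    using sum_outer_in_span[OF B(1,4)] sum_outer_diff_in[OF B(1,4)] B(3) assms
    by (intro proj_matrix_unique) auto
  show "transpose (proj_matrix W) = proj_matrix W"
    by (simp add: P transpose_sum transpose_outer)
  have "trace (proj_matrix W) = (\<Sum>b\<in>B. trace (outer b b))"
    unfolding P by (simp add: trace_def sum.swap[of _ B])
  then show "trace (proj_matrix W) = real (dim W)"
    using B by (simp add: trace_outer)
  show "proj_matrix W *v x \<in> W" "x - proj_matrix W *v x \<in> orthogonal_comp W"
    using sum_outer_in_span[OF B(1,4)] sum_outer_diff_in[OF B(1,4)] B(3) by (simp_all add: P)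
qed

lemma proj_matrix_fixes_iff:
  assumes "subspace W" shows "proj_matrix W *v x = x \<longleftrightarrow> x \<in> W"
proof
  assume "x \<in> W"
  then have "x - proj_matrix W *v x \<in> W"
    using assms proj_matrix_in subspace_diff by blast
  then show "proj_matrix W *v x = x"
    using orthogonal_comp_Int_eq_0 proj_matrix_diff_in[OF assms] by fastforce
qed (use proj_matrix_in[OF assms] in metis)

lemma proj_matrix_eq_0_iff:
  assumes "subspace W" shows "proj_matrix W *v x = 0 \<longleftrightarrow> x \<in> orthogonal_comp W"
proof
  assume "x \<in> orthogonal_comp W"
  then have "x - (x - proj_matrix W *v x) \<in> orthogonal_comp W"
    using subspace_diff[OF subspace_orthogonal_comp] proj_matrix_diff_in[OF assms] by blast
  then show "proj_matrix W *v x = 0"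
    using orthogonal_comp_Int_eq_0 proj_matrix_in[OF assms] by fastforce
qed (use proj_matrix_diff_in[OF assms, of x] in simp)

lemma proj_matrix_idem:
  assumes "subspace W" shows "proj_matrix W ** proj_matrix W = proj_matrix W"
  unfolding matrix_eq matrix_vector_mul_assoc[symmetric]
  using proj_matrix_fixes_iff proj_matrix_in assms by blast

lemma proj_matrix_orthogonal_comp:
  assumes "subspace W" shows "proj_matrix (orthogonal_comp W) = mat 1 - proj_matrix W"
proof (rule proj_matrix_unique)
  show "subspace (orthogonal_comp W)" by (rule subspace_orthogonal_comp)
next
  fix x
  show "(mat 1 - proj_matrix W) *v x \<in> orthogonal_comp W"
    using assms by (simp add: matrix_vector_mult_diff_rdistrib proj_matrix_diff_in)
  show "x - (mat 1 - proj_matrix W) *v x \<in> orthogonal_comp (orthogonal_comp W)"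
    using assms orthogonal_comp_subset[of W] proj_matrix_in[of W x]
    by (auto simp: matrix_vector_mult_diff_rdistrib)
qed

text \<open>Symmetry moves \<open>P\<close> across the inner product: the product of P y with x - P
  x is that of y with P x - P P x = 0.\<close>

lemma idempotent_symmetric_eq_proj_matrix:
  fixes P :: "real^'n^'n"
  assumes "P ** P = P" "transpose P = P"
  shows "proj_matrix (range ((*v) P)) = P"
proof (rule proj_matrix_unique)
  show "subspace (range ((*v) P))"
    by (simp add: linear_subspace_image)
next
  fix x
  have "(P *v y) \<bullet> (x - P *v x) = 0" for y
  proof -
    have "(P *v y) \<bullet> (x - P *v x) = y \<bullet> (P *v (x - P *v x))"
      by (metis inner_matrix_vector_transpose assms(2))
    then show ?thesis
      by (simp add: matrix_vector_mult_diff_distrib matrix_vector_mul_assoc assms)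
  qed
  then show "x - P *v x \<in> orthogonal_comp (range ((*v) P))"
    by (auto simp: orthogonal_comp_iff)
qed simp

text \<open>The traces of P and 1 - P add up to n. Working in the reals avoids truncated
  subtraction.\<close>

lemma dim_orthogonal_comp:
  fixes W :: "(real^'n) set"
  assumes "subspace W" shows "real (dim (orthogonal_comp W)) = real CARD('n) - real (dim W)"
  using trace_proj_matrix[OF assms] trace_proj_matrix[OF subspace_orthogonal_comp, of W]
  by (simp add: proj_matrix_orthogonal_comp[OF assms] trace_sub trace_I)

section \<open>Reflections and the matrix model\<close>

lemma grassmann_reflection_eq:
  "subspace W \<Longrightarrow> grassmann_reflection W = 2 *\<^sub>R proj_matrix W - mat 1"
  by (simp add: grassmann_reflection_def proj_matrix_orthogonal_comp scaleR_2)

text \<open>The equation 2 P x - x = x says P x = x. Recovering \<open>W\<close> as the 1-eigenspace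
  gives both the injectivity of the map and the formula for its inverse.\<close>

lemma grassmann_reflection_fixes_iff:
  assumes "subspace W" shows "grassmann_reflection W *v x = x \<longleftrightarrow> x \<in> W"
proof -
  have "grassmann_reflection W *v x = x \<longleftrightarrow> 2 *\<^sub>R (proj_matrix W *v x) = 2 *\<^sub>R x"
    by (simp add: grassmann_reflection_eq assms matrix_vector_mult_diff_rdistrib
        scaleR_matrix_vector_assoc[symmetric] scaleR_2[of x] diff_eq_eq)
  also have "\<dots> \<longleftrightarrow> x \<in> W"
    using assms proj_matrix_fixes_iff by (metis scaleR_cancel_left zero_neq_numeral)
  finally show ?thesis .
qed

text \<open>A symmetric orthogonal Q is an involution, so P = (Q + 1)/2 is symmetric and idempotent,
  hence the projection onto its range, and tr P = (tr Q + n)/2 = k is the dimension. Conversely 2 P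
  - 1 is symmetric, squares to 1 and has trace 2 k - n.\<close>

lemma reflection_model_eq:
  "reflection_model k = grassmann_reflection ` (Grassmannian k :: (real^'n) set set)"
proof safe
  fix Q :: "real^'n^'n" assume "Q \<in> reflection_model k"
  then have Q: "Q ** Q = mat 1" "transpose Q = Q" "trace Q = 2 * real k - real CARD('n)"
    by (auto simp: reflection_model_def orthogonal_matrix_def)
  define P where "P = (1/2) *\<^sub>R (Q + mat 1)"
  define W where "W = range ((*v) P)"
  have "P ** P = P"
    by (simp add: P_def matrix_ring_simps Q scaleR_2[symmetric] algebra_simps)
  moreover have "transpose P = P"
    by (simp add: P_def transpose_scalar transpose_add Q)
  ultimately have P: "proj_matrix W = P"
    unfolding W_def by (rule idempotent_symmetric_eq_proj_matrix)
  have W: "subspace W" unfolding W_def by (simp add: linear_subspace_image)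
  have "trace P = real k"
    using Q(3) by (simp add: P_def trace_def sum_divide_distrib[symmetric] sum.distrib mat_def)
  then have "dim W = k"
    using trace_proj_matrix[OF W] P by simp
  then show "Q \<in> grassmann_reflection ` Grassmannian k"
    using W by (intro image_eqI[of _ _ W]) (simp_all add: grassmann_reflection_eq P P_def Grassmannian_def)
next
  fix W :: "(real^'n) set" assume "W \<in> Grassmannian k"
  then have W: "subspace W" "dim W = k" by (auto simp: Grassmannian_def)
  have "trace (2 *\<^sub>R proj_matrix W - mat 1) = 2 * trace (proj_matrix W) - real CARD('n)"
    by (simp add: trace_sub trace_I) (simp add: trace_def sum_distrib_left)
  moreover have "transpose (2 *\<^sub>R proj_matrix W - mat 1) = 2 *\<^sub>R proj_matrix W - mat 1"
    using W by (simp add: transpose_diff transpose_scalar transpose_proj_matrix)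
  moreover have "(2 *\<^sub>R proj_matrix W - mat 1) ** (2 *\<^sub>R proj_matrix W - mat 1) = mat 1"
  proof -
    have "(2 *\<^sub>R proj_matrix W) ** (2 *\<^sub>R proj_matrix W) = 2 *\<^sub>R proj_matrix W + 2 *\<^sub>R proj_matrix W"
      using W by (simp add: matrix_scaleR_left matrix_scaleR_right proj_matrix_idem flip: scaleR_add_left)
    then show ?thesis
      by (simp add: matrix_diff_ldistrib matrix_diff_rdistrib del: scaleR_add_left)
  qed
  ultimately show "grassmann_reflection W \<in> reflection_model k"
    using W by (simp add: reflection_model_def grassmann_reflection_eq orthogonal_matrix
        trace_proj_matrix)
qed

lemma inj_on_grassmann_reflection: "inj_on grassmann_reflection (Grassmannian k)"
proof (rule inj_onI)
  fix V W :: "(real^'n) set"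
  assume "V \<in> Grassmannian k" "W \<in> Grassmannian k"
    and eq: "grassmann_reflection V = grassmann_reflection W"
  then have "subspace V" "subspace W" by (auto simp: Grassmannian_def)
  then show "V = W"
    using grassmann_reflection_fixes_iff eq by (metis set_eqI)
qed


section \<open>Subspaces as graphs\<close>

text \<open>Since \<open>matrix_ring_simps\<close> associates products to the right, a rule for
  \<open>A ** B\<close> no longer matches inside a longer product; this form does.\<close>

lemma matrix_mult_absorb:
  fixes A :: "real^'n^'n"
  assumes "A ** B = C"
  shows "A ** (B ** D) = C ** D"
  by (simp add: matrix_mul_assoc assms)

text \<open>For a projection \<open>P\<close> onto W these are the matrices with only a lower left
  block, i.e. the maps from W to its complement extended by zero.\<close>

definition slope_space :: "real^'n^'n \<Rightarrow> (real^'n^'n) set" where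
  "slope_space P = {X. X ** P = X \<and> P ** X = 0}"

text \<open>The upper left block M11 of \<open>M\<close>, completed by the identity on the
  complement. Invertibility of the block thus becomes invertibility of a full matrix.\<close>

definition pivot :: "real^'n^'n \<Rightarrow> real^'n^'n \<Rightarrow> real^'n^'n" where
  "pivot P M = P ** M ** P + (mat 1 - P)"

text \<open>In block notation this is M21 M11^-1.\<close>

definition slope :: "real^'n^'n \<Rightarrow> real^'n^'n \<Rightarrow> real^'n^'n" where
  "slope P M = (mat 1 - P) ** M ** P ** matrix_inv (pivot P M)"

text \<open>The projection formula A (A^T A)^-1 A^T for A = P + X. As A^T A = P + X^T X may be
  singular, the always invertible 1 + X^T X takes its place.\<close>

definition graph_proj :: "real^'n^'n \<Rightarrow> real^'n^'n \<Rightarrow> real^'n^'n" where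
  "graph_proj P X = (P + X) ** matrix_inv (mat 1 + transpose X ** X) ** (P + transpose X)"

definition matrix_graph :: "(real^'n) set \<Rightarrow> real^'n^'n \<Rightarrow> (real^'n) set" where
  "matrix_graph W X = (\<lambda>x. x + X *v x) ` W"

lemma slope_space_square: "X \<in> slope_space P \<Longrightarrow> X ** X = 0"
  unfolding slope_space_def
  by (metis (mono_tags, lifting) matrix_mul_assoc matrix_zero_right mem_Collect_eq)

context
  fixes P M :: "real^'n^'n"
  assumes idem: "P ** P = P" and inv: "invertible (pivot P M)"
begin

lemma pivot_commute: "pivot P M ** P = P ** M ** P" "P ** pivot P M = P ** M ** P"
  by (simp_all add: pivot_def matrix_ring_simps idem matrix_mult_absorb[OF idem])

lemma matrix_inv_pivot_commute: "P ** matrix_inv (pivot P M) = matrix_inv (pivot P M) ** P"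
proof -
  let ?a = "pivot P M" and ?i = "matrix_inv (pivot P M)"
  have "P ** ?i = ?i ** (?a ** P) ** ?i"
    by (simp add: matrix_mul_assoc matrix_inv_left inv)
  also have "\<dots> = ?i ** (P ** ?a) ** ?i"
    by (simp only: pivot_commute)
  also have "\<dots> = ?i ** P"
    by (simp add: matrix_mul_assoc[symmetric] matrix_inv_right inv)
  finally show ?thesis .
qed

lemma slope_in_slope_space: "slope P M \<in> slope_space P"
  unfolding slope_space_def slope_def
  by (simp add: matrix_ring_simps matrix_inv_pivot_commute[symmetric] idem
      matrix_mult_absorb[OF idem])

lemma slope_mult_pivot: "slope P M ** pivot P M = (mat 1 - P) ** M ** P"
  by (simp add: slope_def matrix_mul_assoc[symmetric] matrix_inv_left inv)

text \<open>As X = X P, the factor M P may be replaced by P M P, which is P times the pivot. In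
  blocks this is the equation X M11 = M21.\<close>

lemma slope_mult: "slope P M ** M ** P = (mat 1 - P) ** M ** P"
proof -
  have "slope P M ** M ** P = slope P M ** (P ** M ** P)"
    using slope_in_slope_space by (simp add: slope_space_def matrix_mul_assoc)
  also have "\<dots> = slope P M ** P ** pivot P M"
    by (simp only: pivot_commute(2)[symmetric] matrix_mul_assoc)
  also have "\<dots> = (mat 1 - P) ** M ** P"
    using slope_in_slope_space slope_mult_pivot by (simp add: slope_space_def)
  finally show ?thesis .
qed

text \<open>The second hypothesis is the block equation X M11 = M21; the invertible pivot cancels on
  the right.\<close>

lemma slope_unique:
  assumes "X ** P = X" "X ** M ** P = (mat 1 - P) ** M ** P"
  shows "slope P M = X"
proof -
  have "slope P M = X ** P ** M ** P ** matrix_inv (pivot P M)"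
    by (simp add: slope_def assms)
  also have "\<dots> = X ** (P ** pivot P M) ** matrix_inv (pivot P M)"
    by (simp only: pivot_commute matrix_mul_assoc)
  also have "\<dots> = X"
    by (simp add: matrix_mul_assoc[symmetric] matrix_inv_right inv assms)
  finally show ?thesis .
qed

text \<open>The left block column M P equals (P + X) times the pivot. Hence P + X takes its values
  in the range of \<open>M\<close>, which will place the graph of the slope inside a given
  subspace.\<close>

lemma add_slope_eq: "P + slope P M = M ** P ** matrix_inv (pivot P M)"
proof -
  have "M ** P = P ** M ** P + (mat 1 - P) ** M ** P"
    by (simp add: matrix_ring_simps)
  also have "\<dots> = (P + slope P M) ** pivot P M"
    by (simp add: matrix_add_rdistrib pivot_commute slope_mult_pivot)
  finally show ?thesis
    by (simp add: matrix_mul_assoc[symmetric] matrix_inv_right inv)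
qed

end

section \<open>Transversal subspaces, their slopes and their projections\<close>

lemma invertible_iff_ker: "invertible (A :: real^'n^'n) \<longleftrightarrow> (\<forall>x. A *v x = 0 \<longrightarrow> x = 0)"
  by (simp add: invertible_left_inverse matrix_left_invertible_ker)

text \<open>Pairing (1 + X^T X) x with x gives |x|^2 + |X x|^2, so the kernel is trivial.\<close>

lemma invertible_add_transpose_mult: "invertible (mat 1 + transpose X ** X :: real^'n^'n)"
  unfolding invertible_iff_ker
proof safe
  fix x assume "(mat 1 + transpose X ** X) *v x = 0"
  then have "x \<bullet> (x + transpose X *v (X *v x)) = 0"
    by (simp add: matrix_vector_mult_add_rdistrib matrix_vector_mul_assoc del: transpose_matrix_vector)
  then have "x \<bullet> x + (X *v x) \<bullet> (X *v x) = 0"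
    by (simp add: inner_right_distrib inner_matrix_vector_transpose del: transpose_matrix_vector)
  then show "x = 0"
    by (metis add_nonneg_eq_0_iff inner_eq_zero_iff inner_ge_zero)
qed

text \<open>By counting dimensions, V and the complement of W together span the whole space. A
  vector of W orthogonal to V is orthogonal to both summands, hence to itself.\<close>

lemma transversal_swap:
  fixes V W :: "(real^'n) set"
  assumes "subspace V" "subspace W" "dim V = dim W" "V \<inter> orthogonal_comp W = {0}"
  shows "W \<inter> orthogonal_comp V = {0}"
proof -
  let ?S = "{x + y |x y. x \<in> V \<and> y \<in> orthogonal_comp W}"
  have "dim ?S + dim (V \<inter> orthogonal_comp W) = dim V + dim (orthogonal_comp W)"
    by (intro dim_sums_Int assms subspace_orthogonal_comp)
  then have "dim ?S = DIM(real^'n)"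
    using dim_orthogonal_comp[OF assms(2)] assms(3,4) by simp
  moreover have "span ?S = ?S"
    by (simp add: subspace_sums assms subspace_orthogonal_comp)
  ultimately have S: "?S = UNIV"
    using dim_eq_full by blast
  have "x = 0" if x: "x \<in> W" "x \<in> orthogonal_comp V" for x
  proof -
    have "x \<in> ?S" using S by blast
    then obtain y z where "x = y + z" "y \<in> V" "z \<in> orthogonal_comp W" by blast
    then have "x \<bullet> x = 0"
      using x by (metis add_0 inner_commute inner_left_distrib orthogonal_comp_iff)
    then show "x = 0" by simp
  qed
  then show ?thesis
    using assms(2) subspace_orthogonal_comp[of V] by (auto simp: subspace_0)
qed

text \<open>The kernel of the pivot is the intersection of W with the complement of V: applying P to
  P M P x + (x - P x) = 0 gives P M P x = 0 and so x = P x, after which 0 = x . P M x = x . M x = |M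
  x|^2. The roles of V and W are then exchanged by \<open>transversal_swap\<close>.\<close>

lemma transversal_iff_invertible_pivot:
  fixes V W :: "(real^'n) set"
  assumes V: "subspace V" and W: "subspace W" and dim: "dim V = dim W"
  shows "V \<inter> orthogonal_comp W = {0} \<longleftrightarrow> invertible (pivot (proj_matrix W) (proj_matrix V))"
    (is "_ \<longleftrightarrow> invertible (pivot ?P ?M)")
proof -
  have pv: "pivot ?P ?M *v x = ?P *v (?M *v (?P *v x)) + (x - ?P *v x)" for x
    by (simp add: pivot_def matrix_vector_mult_add_rdistrib matrix_vector_mult_diff_rdistrib
        matrix_vector_mul_assoc matrix_mul_assoc)
  have "pivot ?P ?M *v x = 0 \<longleftrightarrow> x \<in> W \<inter> orthogonal_comp V" for x
  proof
    have PP: "?P *v (?P *v z) = ?P *v z" for z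
      by (simp add: proj_matrix_fixes_iff proj_matrix_in W)
    assume x: "pivot ?P ?M *v x = 0"
    then have eq: "?P *v (?M *v (?P *v x)) + (x - ?P *v x) = 0" by (simp add: pv)
    then have "?P *v (?P *v (?M *v (?P *v x)) + (x - ?P *v x)) = 0" by simp
    then have 0: "?P *v (?M *v (?P *v x)) = 0"
      unfolding matrix_vector_right_distrib matrix_vector_mult_diff_distrib PP by simp
    then have xW: "?P *v x = x" using eq by simp
    then have "x \<bullet> (?P *v (?M *v x)) = 0" using 0 by simp
    then have "x \<bullet> (?M *v x) = 0"
      by (metis inner_matrix_vector_transpose transpose_proj_matrix W xW)
    then have "x \<bullet> (?M *v (?M *v x)) = 0"
      by (simp add: matrix_vector_mul_assoc proj_matrix_idem V)
    then have "(?M *v x) \<bullet> (?M *v x) = 0"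
      by (metis inner_matrix_vector_transpose transpose_proj_matrix V)
    then show "x \<in> W \<inter> orthogonal_comp V"
      using xW by (simp add: proj_matrix_fixes_iff[OF W] proj_matrix_eq_0_iff[OF V])
  next
    assume "x \<in> W \<inter> orthogonal_comp V"
    then show "pivot ?P ?M *v x = 0"
      using proj_matrix_fixes_iff[OF W, of x] proj_matrix_eq_0_iff[OF V, of x] by (simp add: pv)
  qed
  then have "invertible (pivot ?P ?M) \<longleftrightarrow> W \<inter> orthogonal_comp V = {0}"
    using subspace_orthogonal_comp[of V] W unfolding invertible_iff_ker
    by (auto simp: subspace_0)
  then show ?thesis
    using transversal_swap[OF V W dim] transversal_swap[OF W V dim[symmetric]] by blast
qed

lemma slope_space_iff:
  assumes "subspace W"
  shows "X \<in> slope_space (proj_matrix W) \<longleftrightarrow>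
    (\<forall>x\<in>W. X *v x \<in> orthogonal_comp W) \<and> (\<forall>x\<in>orthogonal_comp W. X *v x = 0)"
proof safe
  fix x assume X: "X \<in> slope_space (proj_matrix W)"
  then have "proj_matrix W *v (X *v x) = 0"
    by (simp add: slope_space_def matrix_vector_mul_assoc)
  then show "X *v x \<in> orthogonal_comp W" by (simp add: proj_matrix_eq_0_iff assms)
  assume x: "x \<in> orthogonal_comp W"
  have "X *v x = X *v (proj_matrix W *v x)"
    using X by (simp add: slope_space_def matrix_vector_mul_assoc)
  then show "X *v x = 0"
    using x by (simp add: proj_matrix_eq_0_iff[OF assms, THEN iffD2])
next
  assume 1: "\<forall>x\<in>W. X *v x \<in> orthogonal_comp W" and 2: "\<forall>x\<in>orthogonal_comp W. X *v x = 0"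
  have XP: "X *v (proj_matrix W *v x) = X *v x" for x
    using 2 proj_matrix_diff_in[OF assms, of x] by (force simp: matrix_vector_mult_diff_distrib)
  moreover have "proj_matrix W *v (X *v x) = 0" for x
    using 1 proj_matrix_in[OF assms, of x] XP[of x] by (metis proj_matrix_eq_0_iff assms)
  ultimately show "X \<in> slope_space (proj_matrix W)"
    by (simp add: slope_space_def matrix_eq matrix_vector_mul_assoc[symmetric])
qed

text \<open>P fixes x and kills X x. This left inverse of the graph parametrisation yields its
  injectivity, the transversality of graphs and the uniqueness of the coordinate.\<close>

lemma proj_matrix_add_slope:
  assumes "subspace W" "X \<in> slope_space (proj_matrix W)" "x \<in> W"
  shows "proj_matrix W *v (x + X *v x) = x"
proof -
  have "proj_matrix W *v x = x" "proj_matrix W *v (X *v x) = 0"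
    using assms by (simp_all add: proj_matrix_fixes_iff slope_space_def matrix_vector_mul_assoc)
  then show ?thesis by (simp add: matrix_vector_right_distrib)
qed

context
  fixes W :: "(real^'n) set" and X :: "real^'n^'n"
  assumes W: "subspace W" and X: "X \<in> slope_space (proj_matrix W)"
begin

lemma subspace_matrix_graph: "subspace (matrix_graph W X)"
  unfolding matrix_graph_def
  by (rule linear_subspace_image[OF _ W]) (auto intro: linear_compose_add linear_ident)

lemma dim_matrix_graph: "dim (matrix_graph W X) = dim W"
  unfolding matrix_graph_def
proof (rule dim_image_eq)
  show "linear (\<lambda>x. x + X *v x)" by (auto intro: linear_compose_add linear_ident)
  have "inj_on (\<lambda>x. x + X *v x) W"
    by (rule inj_on_inverseI[where g = "(*v) (proj_matrix W)"]) (rule proj_matrix_add_slope[OF W X])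
  then show "inj_on (\<lambda>x. x + X *v x) (span W)"
    using W by (metis span_eq_iff)
qed

lemma matrix_graph_in_graph_domain: "matrix_graph W X \<in> graph_domain W"
proof -
  have "x + X *v x = 0" if "x \<in> W" "x + X *v x \<in> orthogonal_comp W" for x
    using proj_matrix_add_slope[OF W X] that proj_matrix_eq_0_iff[OF W]
    by (metis add_0 matrix_vector_mult_0_right)
  then have "matrix_graph W X \<inter> orthogonal_comp W = {0}"
    using subspace_matrix_graph subspace_orthogonal_comp[of W]
    by (auto simp: matrix_graph_def subspace_0)
  then show ?thesis
    by (simp add: graph_domain_def Grassmannian_def subspace_matrix_graph dim_matrix_graph)
qed

text \<open>If x + X x = y + Y y, applying P forces x = y, so X and Y agree on W. Both factor
  through P, so they agree everywhere.\<close>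

lemma graph_coord_matrix_graph: "graph_coord W (matrix_graph W X) = X"
  unfolding graph_coord_def
proof (rule the_equality)
  show "(\<forall>x\<in>W. X *v x \<in> orthogonal_comp W) \<and> (\<forall>x\<in>orthogonal_comp W. X *v x = 0) \<and>
      matrix_graph W X = {x + X *v x |x. x \<in> W}"
    using X slope_space_iff[OF W] by (auto simp: matrix_graph_def)
next
  fix Y
  assume Y: "(\<forall>x\<in>W. Y *v x \<in> orthogonal_comp W) \<and> (\<forall>x\<in>orthogonal_comp W. Y *v x = 0) \<and>
      matrix_graph W X = {x + Y *v x |x. x \<in> W}"
  then have Y': "Y \<in> slope_space (proj_matrix W)" using slope_space_iff[OF W] by blast
  have on: "Y *v x = X *v x" if "x \<in> W" for x
  proof -
    have "x + X *v x \<in> {x + Y *v x |x. x \<in> W}"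
      using Y that by (auto simp: matrix_graph_def)
    then obtain y where y: "y \<in> W" "x + X *v x = y + Y *v y" by blast
    then have "x = y"
      using proj_matrix_add_slope[OF W X that] proj_matrix_add_slope[OF W Y' y(1)] by simp
    then show ?thesis using y by simp
  qed
  have "Y *v x = X *v x" for x
    using on[OF proj_matrix_in[OF W]] X Y'
    by (metis (mono_tags, lifting) matrix_vector_mul_assoc mem_Collect_eq slope_space_def)
  then show "Y = X" by (simp add: matrix_eq)
qed

text \<open>For A = P + X one has A^T A = P (1 + X^T X), hence A^T times \<open>graph_proj\<close>
  is again A^T. So A^T annihilates the residual, which is therefore orthogonal to every A y = y + X
  y with y in W.\<close>

lemma proj_matrix_matrix_graph: "proj_matrix (matrix_graph W X) = graph_proj (proj_matrix W) X"
proof (rule proj_matrix_unique)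
  let ?P = "proj_matrix W" and ?K = "matrix_inv (mat 1 + transpose X ** X)"
  have XP: "X ** ?P = X" "?P ** X = 0" using X by (auto simp: slope_space_def)
  have XtP: "transpose X ** ?P = 0" "?P ** transpose X = transpose X"
    using arg_cong[OF XP(1), of transpose] arg_cong[OF XP(2), of transpose]
    by (simp_all add: matrix_transpose_mul transpose_proj_matrix W transpose_zero)
  show "subspace (matrix_graph W X)" by (rule subspace_matrix_graph)
  fix x
  \<comment> \<open>Each value of P + X is the graph point over P z.\<close>
  have add: "(?P + X) *v z = ?P *v z + X *v (?P *v z)" for z
    by (simp add: matrix_vector_mult_add_rdistrib matrix_vector_mul_assoc XP)
  show "graph_proj ?P X *v x \<in> matrix_graph W X"
    unfolding graph_proj_def matrix_vector_mul_assoc[symmetric] add matrix_graph_def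
    using proj_matrix_in[OF W] by blast
  have "(?P + transpose X) ** (?P + X) = ?P ** (mat 1 + transpose X ** X)"
    by (simp add: matrix_ring_simps XP XtP proj_matrix_idem W matrix_mult_absorb[OF XtP(2)])
  then have "(?P + transpose X) ** graph_proj ?P X
      = ?P ** ((mat 1 + transpose X ** X) ** ?K) ** (?P + transpose X)"
    by (simp add: graph_proj_def matrix_mul_assoc)
  then have key: "(?P + transpose X) ** graph_proj ?P X = ?P + transpose X"
    by (simp add: matrix_inv_right invertible_add_transpose_mult matrix_add_ldistrib XtP
        proj_matrix_idem W)
  have "(y + X *v y) \<bullet> (x - graph_proj ?P X *v x) = 0" if "y \<in> W" for y
  proof -
    have "y + X *v y = (?P + X) *v y"
      using that proj_matrix_fixes_iff[OF W, of y] by (simp add: matrix_vector_mult_add_rdistrib)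
    then have "(y + X *v y) \<bullet> (x - graph_proj ?P X *v x)
        = y \<bullet> ((?P + transpose X) *v (x - graph_proj ?P X *v x))"
      by (simp only: inner_matrix_vector_transpose[of y] transpose_add transpose_transpose
          transpose_proj_matrix[OF W])
    also have "\<dots> = 0"
      by (simp add: matrix_vector_mult_diff_distrib matrix_vector_mul_assoc key)
    finally show ?thesis .
  qed
  then show "x - graph_proj ?P X *v x \<in> orthogonal_comp (matrix_graph W X)"
    by (auto simp: orthogonal_comp_iff matrix_graph_def)
qed

end

lemma graph_domain_iff:
  assumes "subspace W"
  shows "V \<in> graph_domain W \<longleftrightarrow>
    V \<in> Grassmannian (dim W) \<and> invertible (pivot (proj_matrix W) (proj_matrix V))"
  using transversal_iff_invertible_pivot[OF _ assms]
  by (auto simp: graph_domain_def Grassmannian_def)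

text \<open>By \<open>add_slope_eq\<close> the graph of the slope lies in V, and equal dimensions
  make it all of V. The uniqueness of graph coordinates and the projection formula for graphs then
  give the rest.\<close>

lemma
  assumes W: "subspace W" and V: "V \<in> graph_domain W"
  shows slope_proj_matrix_in: "slope (proj_matrix W) (proj_matrix V) \<in> slope_space (proj_matrix W)"
    and matrix_graph_slope: "matrix_graph W (slope (proj_matrix W) (proj_matrix V)) = V"
    and graph_coord_eq_slope: "graph_coord W V = slope (proj_matrix W) (proj_matrix V)"
    and graph_proj_slope:
      "graph_proj (proj_matrix W) (slope (proj_matrix W) (proj_matrix V)) = proj_matrix V"
proof -
  let ?P = "proj_matrix W" and ?M = "proj_matrix V"
  have V': "subspace V" "dim V = dim W" and inv: "invertible (pivot ?P ?M)"
    using V graph_domain_iff[OF W] by (auto simp: Grassmannian_def)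
  note idem = proj_matrix_idem[OF W]
  show X: "slope ?P ?M \<in> slope_space ?P" by (rule slope_in_slope_space[OF idem inv])
  have "x + slope ?P ?M *v x \<in> V" if "x \<in> W" for x
  proof -
    have "x + slope ?P ?M *v x = (?P + slope ?P ?M) *v x"
      using that proj_matrix_fixes_iff[OF W, of x] by (simp add: matrix_vector_mult_add_rdistrib)
    also have "\<dots> = ?M *v (?P *v (matrix_inv (pivot ?P ?M) *v x))"
      by (simp add: add_slope_eq[OF idem inv] matrix_vector_mul_assoc matrix_mul_assoc)
    also have "\<dots> \<in> V" by (rule proj_matrix_in[OF V'(1)])
    finally show ?thesis .
  qed
  then have sub: "matrix_graph W (slope ?P ?M) \<subseteq> V" by (auto simp: matrix_graph_def)
  show eq: "matrix_graph W (slope ?P ?M) = V"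
    by (rule subspace_dim_equal[OF subspace_matrix_graph[OF W X] V'(1) sub])
      (simp add: dim_matrix_graph[OF W X] V')
  show "graph_coord W V = slope ?P ?M"
    using graph_coord_matrix_graph[OF W X] eq by simp
  show "graph_proj ?P (slope ?P ?M) = ?M"
    using proj_matrix_matrix_graph[OF W X] eq by simp
qed

lemma subspace_slope_space: "subspace (slope_space P)"
  by (auto simp: subspace_def slope_space_def matrix_ring_simps)

text \<open>The rank-one matrices c b^T, with b and c from orthonormal bases of W and of its
  complement, form an orthonormal basis, because the inner product of two of them
  factorises.\<close>

lemma dim_slope_space:
  fixes W :: "(real^'n) set"
  assumes "subspace W"
  shows "dim (slope_space (proj_matrix W)) = dim W * (CARD('n) - dim W)"
proof -
  obtain B where B: "finite B" "card B = dim W" "span B = W"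
    "\<And>b c. b \<in> B \<Longrightarrow> c \<in> B \<Longrightarrow> b \<bullet> c = (if b = c then 1 else 0)"
    using orthonormal_basis[OF assms] by metis
  obtain C where C: "finite C" "card C = dim (orthogonal_comp W)" "span C = orthogonal_comp W"
    "\<And>b c. b \<in> C \<Longrightarrow> c \<in> C \<Longrightarrow> b \<bullet> c = (if b = c then 1 else 0)"
    using orthonormal_basis[OF subspace_orthogonal_comp] by metis
  let ?f = "\<lambda>(c, b). outer c b"
  define E where "E = ?f ` (C \<times> B)"
  have f: "?f p \<bullet> ?f q = (if p = q then 1 else 0)" if "p \<in> C \<times> B" "q \<in> C \<times> B" for p q
    using that by (auto simp: inner_outer B(4) C(4) split: if_splits)
  have inj: "inj_on ?f (C \<times> B)"
    by (rule inj_onI) (metis f zero_neq_one)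
  have PB: "proj_matrix W = (\<Sum>b\<in>B. outer b b)"
    using sum_outer_in_span[OF B(1,4)] sum_outer_diff_in[OF B(1,4)] B(3) assms
    by (intro proj_matrix_unique) auto
  have E: "E \<subseteq> slope_space (proj_matrix W)"
  proof -
    have "outer c b \<in> slope_space (proj_matrix W)" if "c \<in> C" "b \<in> B" for c b
    proof -
      have c: "c \<in> orthogonal_comp W" using C(3) that span_base by blast
      moreover have "b \<bullet> x = 0" if "x \<in> orthogonal_comp W" for x
        using that \<open>b \<in> B\<close> B(3) span_base by (auto simp: orthogonal_comp_iff)
      ultimately show ?thesis
        unfolding slope_space_iff[OF assms]
        by (auto simp: outer_mult_vec intro: subspace_scale[OF subspace_orthogonal_comp])
    qed
    then show ?thesis by (auto simp: E_def)
  qed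
  moreover have "slope_space (proj_matrix W) \<subseteq> span E"
  proof
    fix X assume X: "X \<in> slope_space (proj_matrix W)"
    have "outer u b \<in> span E" if "u \<in> span C" "b \<in> B" for u b
    proof -
      have lin: "linear (\<lambda>u. outer u b)"
        by (rule linearI) (auto simp: outer_def vec_eq_iff algebra_simps)
      have "outer u b \<in> span ((\<lambda>u. outer u b) ` C)"
        using that(1) unfolding linear_span_image[OF lin] by (rule imageI)
      also have "\<dots> \<subseteq> span E"
        by (rule span_mono) (auto simp: E_def that(2))
      finally show ?thesis .
    qed
    moreover have "X *v b \<in> span C" if "b \<in> B" for b
      using X that B(3) C(3) slope_space_iff[OF assms] span_base by blast
    ultimately have "(\<Sum>b\<in>B. outer (X *v b) b) \<in> span E"
      by (intro span_sum) auto
    \<comment> \<open>Writing P as the sum of b b^T turns X = X P into the sum of (X b) b^T, where X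
      b lies in the span of \<open>C\<close>.\<close>
    moreover have "X = X ** proj_matrix W" using X by (simp add: slope_space_def)
    moreover have "X ** proj_matrix W = (\<Sum>b\<in>B. outer (X *v b) b)"
      by (simp add: PB matrix_eq matrix_vector_mul_assoc[symmetric] sum_matrix_vector_mult
          outer_mult_vec linear_sum[OF matrix_vector_mul_linear] matrix_vector_mult_scaleR)
    ultimately show "X \<in> span E" by simp
  qed
  moreover have "independent E"
  proof (rule pairwise_orthogonal_independent)
    show "pairwise orthogonal E"
      unfolding pairwise_def orthogonal_def E_def using f by (smt (verit) image_iff)
    show "0 \<notin> E"
      unfolding E_def using f by (metis (no_types, lifting) image_iff inner_zero_left zero_neq_one)
  qed
  ultimately have "dim (slope_space (proj_matrix W)) = card E"
    by (metis basis_card_eq_dim)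
  also have "\<dots> = card C * card B"
    unfolding E_def by (simp add: card_image[OF inj] card_cartesian_product)
  also have "card C = CARD('n) - dim W"
    using dim_orthogonal_comp[OF assms] C(2) by linarith
  finally show ?thesis by (simp add: B(2) mult.commute)
qed


section \<open>Straightening the set of projections\<close>

definition straighten :: "real^'n^'n \<Rightarrow> real^'n^'n \<Rightarrow> real^'n^'n" where
  "straighten P M = slope P M + (mat 1 - slope P M) ** (M - graph_proj P (slope P M))"

text \<open>The slope is read off as the lower left block of \<open>Z\<close>, without inverting a
  pivot, so the formula is smooth on all matrices.\<close>

definition unstraighten :: "real^'n^'n \<Rightarrow> real^'n^'n \<Rightarrow> real^'n^'n" where
  "unstraighten P Z = (let X = (mat 1 - P) ** Z ** P in
     graph_proj P X + (mat 1 + X) ** (Z - X))"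

text \<open>Since X P = X and X^2 = 0, (1 - X) (P + X) = P, which is killed by 1 - P.\<close>

lemma slope_space_graph_proj:
  assumes "P ** P = P" "X \<in> slope_space P"
  shows "(mat 1 - P) ** (mat 1 - X) ** graph_proj P X = 0"
proof -
  have "(mat 1 - P) ** (mat 1 - X) ** (P + X) = 0"
    using assms(2) slope_space_square[OF assms(2)]
    by (simp add: slope_space_def matrix_ring_simps assms(1) matrix_mult_absorb[of P X 0])
  then show ?thesis
    unfolding graph_proj_def by (simp only: matrix_mul_assoc matrix_zero_left)
qed

lemma corner_slope_space: "P ** P = P \<Longrightarrow> (mat 1 - P) ** Z ** P \<in> slope_space P"
  by (simp add: slope_space_def matrix_ring_simps matrix_mult_absorb[of P P P])

lemma slope_space_corner:
  "X \<in> slope_space P \<Longrightarrow> (mat 1 - P) ** X ** P = X"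
  by (simp add: slope_space_def matrix_ring_simps)

lemma slope_space_inverse:
  assumes "X \<in> slope_space P"
  shows "(mat 1 + X) ** (mat 1 - X) = mat 1" "(mat 1 - X) ** (mat 1 + X) = mat 1"
  using slope_space_square[OF assms] by (simp_all add: matrix_ring_simps)

lemma unstraighten_slope_space:
  "X \<in> slope_space P \<Longrightarrow> unstraighten P X = graph_proj P X"
  by (simp add: unstraighten_def slope_space_corner matrix_zero_right)

text \<open>The lower left block of (1 - X) M is M21 - X M11 = 0, and that of (1 - X) times
  \<open>graph_proj\<close> vanishes too. So the block of the straightened matrix is X itself, and 1
  + X undoes 1 - X.\<close>

lemma unstraighten_straighten:
  assumes idem: "P ** P = P" and inv: "invertible (pivot P M)"
  shows "unstraighten P (straighten P M) = M"
proof -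
  let ?X = "slope P M"
  have X: "?X \<in> slope_space P" by (rule slope_in_slope_space[OF idem inv])
  have "(mat 1 - P) ** (mat 1 - ?X) ** M ** P = (mat 1 - P) ** M ** P - ?X ** M ** P"
    using X by (simp add: slope_space_def matrix_ring_simps matrix_mult_absorb[of P ?X 0])
  then have "(mat 1 - P) ** (mat 1 - ?X) ** M ** P = 0"
    by (simp add: slope_mult[OF idem inv])
  then have "(mat 1 - P) ** ((mat 1 - ?X) ** (M - graph_proj P ?X)) ** P = 0"
    unfolding matrix_mul_assoc
    unfolding matrix_diff_ldistrib[of _ M] slope_space_graph_proj[OF idem X] by simp
  then have "(mat 1 - P) ** straighten P M ** P = ?X"
    by (simp add: straighten_def matrix_add_ldistrib matrix_add_rdistrib slope_space_corner[OF X])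
  then show ?thesis
    by (simp add: unstraighten_def straighten_def matrix_mul_assoc slope_space_inverse[OF X])
qed

text \<open>With X the lower left block of Z, that of (1 - X) times the reconstructed matrix is the
  block of Z - X, which is 0. This is the equation characterising the slope, so the slope is
  X.\<close>

lemma straighten_unstraighten:
  assumes idem: "P ** P = P" and inv: "invertible (pivot P (unstraighten P Z))"
  shows "straighten P (unstraighten P Z) = Z"
proof -
  define X where "X = (mat 1 - P) ** Z ** P"
  have X: "X \<in> slope_space P" unfolding X_def by (rule corner_slope_space[OF idem])
  let ?M = "unstraighten P Z"
  have M: "?M = graph_proj P X + (mat 1 + X) ** (Z - X)"
    by (simp add: unstraighten_def X_def Let_def)
  have "(mat 1 - P) ** (mat 1 - X) ** ?M ** P = (mat 1 - P) ** (Z - X) ** P"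
  proof -
    have "(mat 1 - P) ** (mat 1 - X) ** ?M =
        (mat 1 - P) ** ((mat 1 - X) ** (mat 1 + X)) ** (Z - X)"
      unfolding M matrix_add_ldistrib[of _ "graph_proj P X"] slope_space_graph_proj[OF idem X]
      by (simp add: matrix_mul_assoc)
    then show ?thesis by (simp add: slope_space_inverse[OF X])
  qed
  also have "\<dots> = 0"
    by (simp add: matrix_diff_ldistrib[of _ Z] matrix_diff_rdistrib[of _ _ P]
        slope_space_corner[OF X] flip: X_def)
  finally have 0: "(mat 1 - P) ** (mat 1 - X) ** ?M ** P = 0" .
  have "(mat 1 - P) ** (mat 1 - X) ** ?M ** P = (mat 1 - P) ** ?M ** P - X ** ?M ** P"
    using X by (simp add: slope_space_def matrix_ring_simps matrix_mult_absorb[of P X 0])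
  then have "slope P ?M = X"
    using 0 X by (intro slope_unique[OF idem inv]) (simp_all add: slope_space_def)
  then show ?thesis
    by (simp add: straighten_def M matrix_mul_assoc slope_space_inverse[OF X])
qed

lemma smooth_on_pivot:
  "open S \<Longrightarrow> smooth_on S f \<Longrightarrow> smooth_on S (\<lambda>x. pivot P (f x))"
  unfolding pivot_def
  by (intro smooth_on_add smooth_on_matrix_mult smooth_on_const) auto

lemma open_pivot: "open {M. invertible (pivot P M)}"
proof -
  have "continuous_on UNIV (pivot P)"
    by (rule smooth_on_imp_continuous_on[OF smooth_on_pivot]) auto
  then show ?thesis
    using open_vimage[OF open_invertible] by (simp add: vimage_def)
qed

lemma smooth_on_slope:
  "smooth_on {M. invertible (pivot P M)} (slope P)"
  unfolding slope_def
  by (intro smooth_on_matrix_mult smooth_on_const smooth_on_matrix_inv smooth_on_pivot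
      smooth_on_ident open_pivot) simp

lemma smooth_on_graph_proj:
  assumes "open S" "smooth_on S f"
  shows "smooth_on S (\<lambda>x. graph_proj P (f x))"
  unfolding graph_proj_def
  by (intro smooth_on_matrix_mult smooth_on_matrix_inv smooth_on_add smooth_on_const
      smooth_on_transpose assms invertible_add_transpose_mult)

lemma smooth_on_straighten:
  "smooth_on {M. invertible (pivot P M)} (straighten P)"
  unfolding straighten_def
  by (intro smooth_on_add smooth_on_diff smooth_on_matrix_mult smooth_on_graph_proj smooth_on_slope
      smooth_on_const smooth_on_ident open_pivot)

lemma smooth_on_unstraighten: "smooth_on UNIV (unstraighten P)"
  unfolding unstraighten_def Let_def
  by (intro smooth_on_add smooth_on_diff smooth_on_matrix_mult smooth_on_graph_proj
      smooth_on_const smooth_on_ident open_UNIV)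

section \<open>The same maps in terms of reflections\<close>

definition refl_to_proj :: "real^'n^'n \<Rightarrow> real^'n^'n" where
  "refl_to_proj Q = (1/2) *\<^sub>R (Q + mat 1)"

definition proj_to_refl :: "real^'n^'n \<Rightarrow> real^'n^'n" where
  "proj_to_refl M = 2 *\<^sub>R M - mat 1"

lemma refl_to_proj_to_refl [simp]: "refl_to_proj (proj_to_refl M) = M"
  by (simp add: refl_to_proj_def proj_to_refl_def)

lemma proj_to_refl_to_proj [simp]: "proj_to_refl (refl_to_proj M) = M"
  by (simp add: refl_to_proj_def proj_to_refl_def)

lemma smooth_on_refl_to_proj: "open S \<Longrightarrow> smooth_on S refl_to_proj"
  unfolding refl_to_proj_def by (intro smooth_on_scaleR smooth_on_add smooth_on_const smooth_on_ident)

lemma smooth_on_proj_to_refl: "open S \<Longrightarrow> smooth_on S f \<Longrightarrow> smooth_on S (\<lambda>x. proj_to_refl (f x))"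
  unfolding proj_to_refl_def by (intro smooth_on_scaleR smooth_on_diff smooth_on_const)

lemma grassmann_reflection_proj:
  "subspace W \<Longrightarrow> grassmann_reflection W = proj_to_refl (proj_matrix W)"
  by (simp add: grassmann_reflection_eq proj_to_refl_def)

text \<open>Not restricted to the model: it is an open set of matrices, on which smoothness is
  available directly.\<close>

definition refl_domain :: "(real^'n) set \<Rightarrow> (real^'n^'n) set" where
  "refl_domain W = {Q. invertible (pivot (proj_matrix W) (refl_to_proj Q))}"

definition refl_slope :: "(real^'n) set \<Rightarrow> real^'n^'n \<Rightarrow> real^'n^'n" where
  "refl_slope W Q = slope (proj_matrix W) (refl_to_proj Q)"

definition refl_graph :: "(real^'n) set \<Rightarrow> real^'n^'n \<Rightarrow> real^'n^'n" where
  "refl_graph W X = proj_to_refl (graph_proj (proj_matrix W) X)"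

definition refl_straighten :: "(real^'n) set \<Rightarrow> real^'n^'n \<Rightarrow> real^'n^'n" where
  "refl_straighten W Q = straighten (proj_matrix W) (refl_to_proj Q)"

definition refl_unstraighten :: "(real^'n) set \<Rightarrow> real^'n^'n \<Rightarrow> real^'n^'n" where
  "refl_unstraighten W Z = proj_to_refl (unstraighten (proj_matrix W) Z)"

lemma open_refl_domain: "open (refl_domain W)"
proof -
  have "continuous_on UNIV (refl_to_proj :: real^'n^'n \<Rightarrow> _)"
    using smooth_on_imp_continuous_on smooth_on_refl_to_proj open_UNIV by blast
  then show ?thesis
    using open_vimage[OF open_pivot] by (simp add: vimage_def refl_domain_def)
qed

lemma smooth_on_refl_slope: "smooth_on (refl_domain W) (refl_slope W)"
  unfolding refl_slope_def
  by (rule smooth_on_compose[OF open_refl_domain open_pivot _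
        smooth_on_refl_to_proj[OF open_refl_domain] smooth_on_slope])
    (auto simp: refl_domain_def)

lemma smooth_on_refl_straighten: "smooth_on (refl_domain W) (refl_straighten W)"
  unfolding refl_straighten_def
  by (rule smooth_on_compose[OF open_refl_domain open_pivot _
        smooth_on_refl_to_proj[OF open_refl_domain] smooth_on_straighten])
    (auto simp: refl_domain_def)

lemma smooth_on_refl_graph: "open S \<Longrightarrow> smooth_on S (refl_graph W)"
  unfolding refl_graph_def by (intro smooth_on_proj_to_refl smooth_on_graph_proj smooth_on_ident)

lemma smooth_on_refl_unstraighten: "smooth_on UNIV (refl_unstraighten W)"
  unfolding refl_unstraighten_def
  by (intro smooth_on_proj_to_refl smooth_on_unstraighten open_UNIV)

lemma open_vimage_refl_graph: "open B \<Longrightarrow> open (refl_graph W -` B)"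
  by (intro open_vimage smooth_on_imp_continuous_on smooth_on_refl_graph open_UNIV)

text \<open>The dictionary for all later arguments: under \<open>grassmann_reflection\<close> a
  chart becomes \<open>refl_slope\<close> and its inverse becomes \<open>refl_graph\<close>, both
  smooth on open sets of matrices.\<close>

lemma
  assumes "V \<in> graph_domain W" "subspace W"
  shows grassmann_reflection_in_refl_domain: "grassmann_reflection V \<in> refl_domain W"
    and refl_slope_grassmann_reflection: "refl_slope W (grassmann_reflection V) = graph_coord W V"
    and refl_graph_graph_coord: "refl_graph W (graph_coord W V) = grassmann_reflection V"
    and graph_coord_in_slope_space: "graph_coord W V \<in> slope_space (proj_matrix W)"
    and matrix_graph_graph_coord: "matrix_graph W (graph_coord W V) = V"
proof -
  have V: "subspace V" using assms by (simp add: graph_domain_def Grassmannian_def)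
  then show "grassmann_reflection V \<in> refl_domain W"
    using graph_domain_iff[of W V] assms by (simp add: refl_domain_def grassmann_reflection_proj)
  show "refl_slope W (grassmann_reflection V) = graph_coord W V"
    using V graph_coord_eq_slope[OF assms(2,1)] by (simp add: refl_slope_def grassmann_reflection_proj)
  show "refl_graph W (graph_coord W V) = grassmann_reflection V"
    using V graph_coord_eq_slope[OF assms(2,1)] graph_proj_slope[OF assms(2,1)]
    by (simp add: refl_graph_def grassmann_reflection_proj)
  show "graph_coord W V \<in> slope_space (proj_matrix W)" "matrix_graph W (graph_coord W V) = V"
    using graph_coord_eq_slope[OF assms(2,1)] slope_proj_matrix_in[OF assms(2,1)]
      matrix_graph_slope[OF assms(2,1)] by simp_all
qed

lemma graph_domain_iff_refl_domain:
  assumes "W \<in> Grassmannian k" "V \<in> Grassmannian k"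
  shows "V \<in> graph_domain W \<longleftrightarrow> grassmann_reflection V \<in> refl_domain W"
  using assms graph_domain_iff[of W V]
  by (auto simp: Grassmannian_def refl_domain_def grassmann_reflection_proj)

lemma grassmann_reflection_matrix_graph:
  assumes "subspace W" "X \<in> slope_space (proj_matrix W)"
  shows "grassmann_reflection (matrix_graph W X) = refl_graph W X"
  using assms by (simp add: grassmann_reflection_proj subspace_matrix_graph
      proj_matrix_matrix_graph refl_graph_def)

lemma graph_domain_subset: "W \<in> Grassmannian k \<Longrightarrow> graph_domain W \<subseteq> Grassmannian k"
  by (auto simp: graph_domain_def Grassmannian_def)

lemma centre_in_graph_domain: "W \<in> Grassmannian k \<Longrightarrow> W \<in> graph_domain W"
  using subspace_0 subspace_orthogonal_comp[of W]
  by (auto simp: graph_domain_def Grassmannian_def dest: orthogonal_comp_Int_eq_0)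

lemma graph_coord_image:
  assumes "subspace W"
  shows "graph_coord W ` graph_domain W = slope_space (proj_matrix W)"
  using graph_coord_in_slope_space[OF _ assms] graph_coord_matrix_graph[OF assms]
    matrix_graph_in_graph_domain[OF assms]
  by (auto simp: image_iff) metis

lemma inj_on_graph_coord: "subspace W \<Longrightarrow> inj_on (graph_coord W) (graph_domain W)"
  by (rule inj_on_inverseI[where g = "matrix_graph W"]) (rule matrix_graph_graph_coord)


section \<open>The two manifolds\<close>

lemma smooth_map_onI:
  assumes "open T" "S \<subseteq> T" "smooth_on T g" "\<And>y. y \<in> S \<Longrightarrow> g y = f y"
  shows "smooth_map_on S f"
  unfolding smooth_map_on_def using assms by blast

lemma second_countable_euclidean:
  "second_countable (euclidean :: 'a::second_countable_topology topology)"
proof -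
  obtain \<B> :: "'a set set" where "countable \<B>" "topological_basis \<B>"
    using ex_countable_basis by blast
  then show ?thesis
    unfolding second_countable_def
    by (metis open_openin topological_basisE topological_basis_open)
qed

lemma inv_into_Int:
  assumes "inj_on f A" "y \<in> f ` (S \<inter> A)"
  shows "inv_into (S \<inter> A) f y = inv_into A f y"
proof -
  obtain x where x: "x \<in> S \<inter> A" "y = f x" using assms(2) by blast
  moreover have "inj_on f (S \<inter> A)" using assms(1) by (rule inj_on_subset) auto
  ultimately show ?thesis using assms(1) by (simp add: inv_into_f_f)
qed

lemma slice_chartsE:
  assumes "(V, \<psi>) \<in> slice_charts d S"
  obtains A L where "V = S \<inter> A" "open A" "open (\<psi> ` A)" "inj_on \<psi> A" "smooth_on A \<psi>"
    "smooth_on (\<psi> ` A) (inv_into A \<psi>)" "subspace L" "dim L = d" "\<psi> ` (S \<inter> A) = \<psi> ` A \<inter> L"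
  using assms unfolding slice_charts_def by blast

lemma manifold_chart_slice_chart:
  assumes "c \<in> slice_charts d S"
  shows "manifold_chart (embedded_submanifold d S) c"
proof -
  obtain V \<psi> where c: "c = (V, \<psi>)" by force
  then obtain A L where A: "V = S \<inter> A" "open A" "open (\<psi> ` A)" "inj_on \<psi> A" "smooth_on A \<psi>"
    "smooth_on (\<psi> ` A) (inv_into A \<psi>)" and L: "subspace L" "dim L = d" "\<psi> ` (S \<inter> A) = \<psi> ` A \<inter> L"
    using assms slice_chartsE by metis
  have "openin (top_of_set S) (S \<inter> A)"
    using A(2) by (rule openin_open_Int)
  moreover have "openin (top_of_set L) (\<psi> ` (S \<inter> A))"
    unfolding L(3) Int_commute[of _ L] using A(3) by (rule openin_open_Int)
  moreover have "homeomorphic_maps (top_of_set (S \<inter> A)) (top_of_set (\<psi> ` (S \<inter> A))) \<psi> (inv_into A \<psi>)"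
    unfolding homeomorphic_maps_def
  proof (intro conjI)
    show "continuous_map (top_of_set (S \<inter> A)) (top_of_set (\<psi> ` (S \<inter> A))) \<psi>"
      using continuous_on_subset[OF smooth_on_imp_continuous_on[OF A(5)]] by auto
    show "continuous_map (top_of_set (\<psi> ` (S \<inter> A))) (top_of_set (S \<inter> A)) (inv_into A \<psi>)"
      using continuous_on_subset[OF smooth_on_imp_continuous_on[OF A(6)], of "\<psi> ` (S \<inter> A)"] A(4)
      by (auto simp: inv_into_f_f)
  qed (use A(4) in \<open>auto simp: f_inv_into_f\<close>)
  then have "homeomorphic_map (top_of_set (S \<inter> A)) (top_of_set (\<psi> ` (S \<inter> A))) \<psi>"
    using homeomorphic_map_maps by blast
  ultimately show ?thesis
    unfolding manifold_chart_def c embedded_submanifold_def A(1)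
    using L(1,2) by (auto simp: subtopology_subtopology)
qed

text \<open>Slice charts are compatible because their transition maps restrict smooth maps between
  open sets of the ambient space; only the covering has to be assumed.\<close>

lemma smooth_manifold_embedded_submanifold:
  assumes cover: "\<And>x. x \<in> S \<Longrightarrow> \<exists>(V, \<psi>)\<in>slice_charts d S. x \<in> V"
  shows "smooth_manifold (embedded_submanifold d S)"
  unfolding smooth_manifold_def
proof (intro conjI)
  show "Hausdorff_space (mtop (embedded_submanifold d S))"
    by (simp add: embedded_submanifold_def Hausdorff_space_subtopology)
  show "second_countable (mtop (embedded_submanifold d S))"
    by (simp add: embedded_submanifold_def second_countable_subtopology second_countable_euclidean)
  show "\<forall>c\<in>matlas (embedded_submanifold d S). manifold_chart (embedded_submanifold d S) c"
    using manifold_chart_slice_chart by (auto simp: embedded_submanifold_def)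
  show "(\<Union>(U, \<phi>)\<in>matlas (embedded_submanifold d S). U) = mcarrier (embedded_submanifold d S)"
    using cover by (fastforce simp: embedded_submanifold_def slice_charts_def)
  have "smooth_map_on (\<phi> ` (U \<inter> V)) (\<psi> \<circ> inv_into U \<phi>)"
    if U: "(U, \<phi>) \<in> slice_charts d S" and V: "(V, \<psi>) \<in> slice_charts d S" for U \<phi> V \<psi>
  proof -
    obtain A where A: "U = S \<inter> A" "open A" "open (\<phi> ` A)" "inj_on \<phi> A"
      "smooth_on (\<phi> ` A) (inv_into A \<phi>)"
      using U by (rule slice_chartsE) blast
    obtain B where B: "V = S \<inter> B" "open B" "smooth_on B \<psi>"
      using V by (rule slice_chartsE) blast
    \<comment> \<open>The open set on which the ambient transition map is defined.\<close>
    define T where "T = \<phi> ` A \<inter> inv_into A \<phi> -` B"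
    have T: "open T"
      unfolding T_def
      using continuous_open_preimage[OF smooth_on_imp_continuous_on[OF A(5)] A(3) B(2)] .
    show ?thesis
    proof (rule smooth_map_onI[OF T])
      show "smooth_on T (\<lambda>y. \<psi> (inv_into A \<phi> y))"
        by (rule smooth_on_compose[OF T B(2) _ smooth_on_subset[OF A(5)] B(3)]) (auto simp: T_def)
      show "\<phi> ` (U \<inter> V) \<subseteq> T"
        using A(1,4) B(1) by (auto simp: T_def inv_into_f_f)
      show "\<psi> (inv_into A \<phi> y) = (\<psi> \<circ> inv_into U \<phi>) y" if "y \<in> \<phi> ` (U \<inter> V)" for y
        using that inv_into_Int[OF A(4), of y S] A(1) by auto
    qed
  qed
  then show "\<forall>(U, \<phi>)\<in>matlas (embedded_submanifold d S). \<forall>(V, \<psi>)\<in>matlas (embedded_submanifold d S).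
      smooth_map_on (\<phi> ` (U \<inter> V)) (\<psi> \<circ> inv_into U \<phi>)"
    by (auto simp: embedded_submanifold_def)
qed

section \<open>The Grassmannian as a smooth manifold\<close>

text \<open>The topology generated by the charts is the one pulled back from the matrices:
  coordinates are continuous in the reflection, and the reflection is continuous in the
  coordinates.\<close>

lemma openin_Grassmann_topology:
  "openin (Grassmann_topology k) T \<longleftrightarrow>
    (\<exists>N. open N \<and> T = Grassmannian k \<inter> grassmann_reflection -` N)"
proof
  let ?S = "{U \<inter> \<phi> -` B |U \<phi> B. (U, \<phi>) \<in> Grassmann_charts k \<and> open B} :: (real^'n) set set set"
  assume "openin (Grassmann_topology k) T"
  then have "generate_topology_on ?S T"
    unfolding Grassmann_topology_def by (rule openin_topology_generated_by)
  then show "\<exists>N. open N \<and> T = Grassmannian k \<inter> grassmann_reflection -` N"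
  proof induction
    case Empty
    then show ?case by (intro exI[of _ "{}"]) auto
  next
    case (Int a b)
    then obtain N1 N2 where "open N1" "a = Grassmannian k \<inter> grassmann_reflection -` N1"
      "open N2" "b = Grassmannian k \<inter> grassmann_reflection -` N2" by blast
    then show ?case by (intro exI[of _ "N1 \<inter> N2"]) auto
  next
    case (UN K)
    then obtain N where "\<And>t. t \<in> K \<Longrightarrow> open (N t)"
      "\<And>t. t \<in> K \<Longrightarrow> t = Grassmannian k \<inter> grassmann_reflection -` N t" by metis
    then show ?case by (intro exI[of _ "\<Union>t\<in>K. N t"]) (auto, blast+)
  next
    case (Basis s)
    then obtain W B where W: "W \<in> Grassmannian k" "s = graph_domain W \<inter> graph_coord W -` B" "open B"
      by (auto simp: Grassmann_charts_def)
    have sW: "subspace W" using W(1) by (simp add: Grassmannian_def)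
    \<comment> \<open>On the chart, \<open>graph_coord W\<close> is \<open>refl_slope W\<close>
      after \<open>grassmann_reflection\<close>, so the generating set \<open>s\<close> is the
      pullback of this set.\<close>
    have "open (refl_domain W \<inter> refl_slope W -` B)"
      using continuous_open_preimage[OF smooth_on_imp_continuous_on[OF smooth_on_refl_slope]
          open_refl_domain W(3)] .
    moreover have "s = Grassmannian k \<inter> grassmann_reflection -` (refl_domain W \<inter> refl_slope W -` B)"
      using W graph_domain_subset[OF W(1)] graph_domain_iff_refl_domain[OF W(1)]
        refl_slope_grassmann_reflection[OF _ sW] by auto
    ultimately show ?case by blast
  qed
next
  assume "\<exists>N. open N \<and> T = Grassmannian k \<inter> grassmann_reflection -` N"
  then obtain N where N: "open N" "T = Grassmannian k \<inter> grassmann_reflection -` N" by blast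
  \<comment> \<open>Each V lies in the chart centred at V itself, and \<open>refl_graph\<close>
    recovers the reflection from the coordinate.\<close>
  have "T = (\<Union>W\<in>Grassmannian k. graph_domain W \<inter> graph_coord W -` (refl_graph W -` N))"
  proof safe
    fix V assume "V \<in> T"
    then have "V \<in> Grassmannian k" "V \<in> graph_domain V" "subspace V" "grassmann_reflection V \<in> N"
      using N centre_in_graph_domain by (auto simp: Grassmannian_def)
    then show "V \<in> (\<Union>W\<in>Grassmannian k. graph_domain W \<inter> graph_coord W -` (refl_graph W -` N))"
      using refl_graph_graph_coord[of V V] by auto
  next
    fix V W assume "W \<in> Grassmannian k" "V \<in> graph_domain W" "refl_graph W (graph_coord W V) \<in> N"
    then show "V \<in> T"
      using N graph_domain_subset[of W k] refl_graph_graph_coord[of V W]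
      by (auto simp: Grassmannian_def)
  qed
  moreover have "openin (Grassmann_topology k) (graph_domain W \<inter> graph_coord W -` (refl_graph W -` N))"
    if "W \<in> Grassmannian k" for W
  proof -
    have "(graph_domain W, graph_coord W) \<in> Grassmann_charts k"
      using that by (auto simp: Grassmann_charts_def)
    with open_vimage_refl_graph[OF N(1), of W] show ?thesis
      unfolding Grassmann_topology_def by (intro topology_generated_by_Basis) blast
  qed
  ultimately show "openin (Grassmann_topology k) T" by auto
qed

lemma topspace_Grassmann_topology:
  "topspace (Grassmann_topology k) = (Grassmannian k :: (real^'n) set set)"
proof
  let ?T = "Grassmann_topology k :: (real^'n) set topology"
  show "topspace ?T \<subseteq> Grassmannian k"
    using openin_topspace[of ?T] unfolding openin_Grassmann_topology by blast
  have "openin ?T (Grassmannian k)"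
    unfolding openin_Grassmann_topology by (intro exI[of _ UNIV]) auto
  then show "Grassmannian k \<subseteq> topspace ?T"
    by (rule openin_subset)
qed

lemma homeomorphic_map_grassmann_reflection:
  "homeomorphic_map (Grassmann_topology k) (top_of_set (reflection_model k)) grassmann_reflection"
proof (rule bijective_open_imp_homeomorphic_map)
  show "continuous_map (Grassmann_topology k) (top_of_set (reflection_model k)) grassmann_reflection"
    unfolding continuous_map_def topspace_Grassmann_topology
  proof (intro conjI allI impI)
    show "grassmann_reflection \<in> Grassmannian k \<rightarrow> topspace (top_of_set (reflection_model k))"
      by (auto simp: reflection_model_eq)
    fix U assume "openin (top_of_set (reflection_model k)) U"
    then obtain N where N: "open N" "U = reflection_model k \<inter> N" by (auto simp: openin_open)
    show "openin (Grassmann_topology k) {x \<in> Grassmannian k. grassmann_reflection x \<in> U}"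
      unfolding openin_Grassmann_topology using N
      by (intro exI[of _ N]) (auto simp: reflection_model_eq)
  qed
  show "open_map (Grassmann_topology k) (top_of_set (reflection_model k)) grassmann_reflection"
    unfolding open_map_def
  proof (intro allI impI)
    fix U assume "openin (Grassmann_topology k) U"
    then obtain N where N: "open N" "U = Grassmannian k \<inter> grassmann_reflection -` N"
      by (auto simp: openin_Grassmann_topology)
    then have "grassmann_reflection ` U = reflection_model k \<inter> N"
      by (auto simp: reflection_model_eq)
    with N(1) show "openin (top_of_set (reflection_model k)) (grassmann_reflection ` U)"
      by (simp add: openin_open_Int)
  qed
qed (simp_all add: topspace_Grassmann_topology reflection_model_eq inj_on_grassmann_reflection)

text \<open>The coordinate is continuous because it is \<open>refl_slope\<close> of the reflection,
  and open because its inverse, followed by the reflection, is \<open>refl_graph\<close>. Its image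
  is the whole model space.\<close>

lemma manifold_chart_Grassmann:
  fixes W :: "(real^'n) set"
  assumes "W \<in> Grassmannian k"
  shows "manifold_chart (Grassmann_manifold k) (graph_domain W, graph_coord W)"
proof -
  let ?L = "slope_space (proj_matrix W)" and ?X = "subtopology (Grassmann_topology k) (graph_domain W)"
  have W: "subspace W" "dim W = k" using assms by (auto simp: Grassmannian_def)
  have dom: "graph_domain W = Grassmannian k \<inter> grassmann_reflection -` refl_domain W"
    using graph_domain_subset[OF assms] graph_domain_iff_refl_domain[OF assms] by blast
  have open_dom: "openin (Grassmann_topology k) (graph_domain W)"
    unfolding openin_Grassmann_topology using dom open_refl_domain by blast
  have top: "topspace ?X = graph_domain W"
    using graph_domain_subset[OF assms] by (auto simp: topspace_Grassmann_topology)
  have "homeomorphic_map ?X (top_of_set ?L) (graph_coord W)"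
  proof (rule bijective_open_imp_homeomorphic_map)
    show "continuous_map ?X (top_of_set ?L) (graph_coord W)"
      unfolding continuous_map_def top
    proof (intro conjI allI impI)
      show "graph_coord W \<in> graph_domain W \<rightarrow> topspace (top_of_set ?L)"
        using graph_coord_in_slope_space[OF _ W(1)] by auto
      fix U assume "openin (top_of_set ?L) U"
      then obtain B where B: "open B" "U = ?L \<inter> B" by (auto simp: openin_open)
      have "open (refl_domain W \<inter> refl_slope W -` B)"
        using continuous_open_preimage[OF smooth_on_imp_continuous_on[OF smooth_on_refl_slope]
            open_refl_domain B(1)] .
      moreover have "{V \<in> graph_domain W. graph_coord W V \<in> U} =
          Grassmannian k \<inter> grassmann_reflection -` (refl_domain W \<inter> refl_slope W -` B)"
        using B(2) dom graph_coord_in_slope_space[OF _ W(1)]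
          refl_slope_grassmann_reflection[OF _ W(1)] by auto
      ultimately have "openin (Grassmann_topology k) {V \<in> graph_domain W. graph_coord W V \<in> U}"
        unfolding openin_Grassmann_topology by blast
      then show "openin ?X {V \<in> graph_domain W. graph_coord W V \<in> U}"
        unfolding openin_open_subtopology[OF open_dom] by auto
    qed
    show "open_map ?X (top_of_set ?L) (graph_coord W)"
      unfolding open_map_def
    proof (intro allI impI)
      fix U assume "openin ?X U"
      then obtain N where N: "open N" "U = Grassmannian k \<inter> grassmann_reflection -` N"
        and sub: "U \<subseteq> graph_domain W"
        by (auto simp: openin_open_subtopology[OF open_dom] openin_Grassmann_topology)
      have "graph_coord W ` U = ?L \<inter> refl_graph W -` N"
      proof (intro equalityI subsetI)
        fix X assume "X \<in> graph_coord W ` U"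
        then show "X \<in> ?L \<inter> refl_graph W -` N"
          using N sub graph_coord_in_slope_space[OF _ W(1)] refl_graph_graph_coord[OF _ W(1)]
          by auto
      next
        fix X assume X: "X \<in> ?L \<inter> refl_graph W -` N"
        then have "matrix_graph W X \<in> U"
          using N grassmann_reflection_matrix_graph[OF W(1)] matrix_graph_in_graph_domain[OF W(1)]
            graph_domain_subset[OF assms] by auto
        then show "X \<in> graph_coord W ` U"
          using X graph_coord_matrix_graph[OF W(1)] by (metis IntD1 image_eqI)
      qed
      then show "openin (top_of_set ?L) (graph_coord W ` U)"
        using open_vimage_refl_graph[OF N(1)] by (simp add: openin_open_Int)
    qed
  qed (use top in \<open>simp_all add: graph_coord_image W inj_on_graph_coord\<close>)
  moreover have "subspace ?L \<and> dim ?L = k * (CARD('n) - k) \<and> openin (top_of_set ?L) ?L"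
    using subspace_slope_space dim_slope_space[OF W(1)] W(2) by auto
  ultimately show ?thesis
    unfolding manifold_chart_def Grassmann_manifold_def
    using open_dom by (auto simp: graph_coord_image W)
qed

text \<open>Separation and countability come from the matrices through the homeomorphism; a
  transition map is \<open>refl_slope W\<close> after \<open>refl_graph V\<close>.\<close>

lemma smooth_manifold_Grassmann:
  "smooth_manifold (Grassmann_manifold k :: ((real^'n) set, real^'n^'n) charted_space)"
  (is "smooth_manifold ?G")
  unfolding smooth_manifold_def
proof (intro conjI)
  have hs: "(Grassmann_topology k :: (real^'n) set topology) homeomorphic_space
      top_of_set (reflection_model k :: (real^'n^'n) set)"
    by (rule homeomorphic_map_imp_homeomorphic_space[OF homeomorphic_map_grassmann_reflection])
  show "Hausdorff_space (mtop ?G)"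
    using homeomorphic_Hausdorff_space[OF hs]
    by (simp add: Grassmann_manifold_def Hausdorff_space_subtopology)
  show "second_countable (mtop ?G)"
    using homeomorphic_space_second_countability[OF hs]
    by (simp add: Grassmann_manifold_def second_countable_subtopology second_countable_euclidean)
  show "\<forall>c\<in>matlas ?G. manifold_chart ?G c"
    using manifold_chart_Grassmann by (auto simp: Grassmann_manifold_def Grassmann_charts_def)
  show "(\<Union>(U, \<phi>)\<in>matlas ?G. U) = mcarrier ?G"
    using centre_in_graph_domain graph_domain_subset
    by (fastforce simp: Grassmann_manifold_def Grassmann_charts_def topspace_Grassmann_topology)
  have "smooth_map_on (graph_coord V ` (graph_domain V \<inter> graph_domain W))
      (graph_coord W \<circ> inv_into (graph_domain V) (graph_coord V))"
    if "V \<in> Grassmannian k" "W \<in> Grassmannian k" for V W :: "(real^'n) set"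
  proof -
    have sub: "subspace V" "subspace W" using that by (auto simp: Grassmannian_def)
    have T: "open (refl_graph V -` refl_domain W)"
      by (rule open_vimage_refl_graph[OF open_refl_domain])
    show ?thesis
    proof (rule smooth_map_onI[OF T])
      show "smooth_on (refl_graph V -` refl_domain W) (\<lambda>X. refl_slope W (refl_graph V X))"
        by (rule smooth_on_compose[OF T open_refl_domain _ smooth_on_refl_graph[OF T]
              smooth_on_refl_slope]) auto
    qed (auto simp: refl_graph_graph_coord refl_slope_grassmann_reflection
        grassmann_reflection_in_refl_domain sub inv_into_f_f[OF inj_on_graph_coord])
  qed
  then show "\<forall>(U, \<phi>)\<in>matlas ?G. \<forall>(V, \<psi>)\<in>matlas ?G.
      smooth_map_on (\<phi> ` (U \<inter> V)) (\<psi> \<circ> inv_into U \<phi>)"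
    by (auto simp: Grassmann_manifold_def Grassmann_charts_def)
qed

section \<open>Slice charts of the matrix model\<close>

lemma refl_straighten_slice_chart:
  fixes W :: "(real^'n) set"
  assumes "W \<in> Grassmannian k"
  shows "(reflection_model k \<inter> refl_domain W, refl_straighten W)
    \<in> slice_charts (k * (CARD('n) - k)) (reflection_model k)"
proof -
  let ?A = "refl_domain W" and ?L = "slope_space (proj_matrix W)"
  have W: "subspace W" "dim W = k" using assms by (auto simp: Grassmannian_def)
  note idem = proj_matrix_idem[OF W(1)]
  have inv1: "refl_unstraighten W (refl_straighten W Q) = Q" if "Q \<in> ?A" for Q
    using that by (simp add: refl_domain_def refl_straighten_def refl_unstraighten_def
        unstraighten_straighten[OF idem])
  have inv2: "refl_straighten W (refl_unstraighten W Z) = Z" if "refl_unstraighten W Z \<in> ?A" for Z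
    using that by (simp add: refl_domain_def refl_straighten_def refl_unstraighten_def
        straighten_unstraighten[OF idem])
  \<comment> \<open>The image is a preimage under the globally continuous inverse formula, hence
    open.\<close>
  have img: "refl_straighten W ` ?A = refl_unstraighten W -` ?A"
    using inv1 inv2 by (auto simp: image_iff) metis
  have open_img: "open (refl_straighten W ` ?A)"
    unfolding img
    by (intro open_vimage open_refl_domain smooth_on_imp_continuous_on smooth_on_refl_unstraighten)
  have inj: "inj_on (refl_straighten W) ?A"
    using inv1 by (rule inj_on_inverseI)
  have "smooth_on (refl_straighten W ` ?A) (inv_into ?A (refl_straighten W))"
  proof (rule smooth_on_cong[OF open_img])
    show "smooth_on (refl_straighten W ` ?A) (refl_unstraighten W)"
      using smooth_on_refl_unstraighten by (rule smooth_on_subset) simp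
  qed (use inv1 inj in \<open>auto simp: inv_into_f_f\<close>)
  moreover have "refl_straighten W ` (reflection_model k \<inter> ?A) = refl_straighten W ` ?A \<inter> ?L"
  proof (intro equalityI subsetI)
    fix Z assume "Z \<in> refl_straighten W ` (reflection_model k \<inter> ?A)"
    then obtain V where V: "V \<in> Grassmannian k" "grassmann_reflection V \<in> ?A"
      "Z = refl_straighten W (grassmann_reflection V)"
      by (auto simp: reflection_model_eq)
    then have dom: "V \<in> graph_domain W"
      using graph_domain_iff_refl_domain[OF assms] by blast
    \<comment> \<open>The projection of V equals \<open>graph_proj\<close> of its slope, so the
      correction term of \<open>straighten\<close> vanishes and only the slope remains.\<close>
    then have "Z = graph_coord W V"
      using V(3) graph_proj_slope[OF W(1) dom] graph_coord_eq_slope[OF W(1) dom] V(1)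
      by (simp add: refl_straighten_def straighten_def grassmann_reflection_proj Grassmannian_def
          matrix_zero_right)
    then show "Z \<in> refl_straighten W ` ?A \<inter> ?L"
      using V(2,3) graph_coord_in_slope_space[OF dom W(1)] by blast
  next
    fix Z assume Z: "Z \<in> refl_straighten W ` ?A \<inter> ?L"
    then have "refl_unstraighten W Z \<in> ?A" using img by auto
    \<comment> \<open>Conversely, on the slope space the second summand of
      \<open>unstraighten\<close> is zero, which leaves the projection onto the graph of Z.\<close>
    moreover have "refl_unstraighten W Z = grassmann_reflection (matrix_graph W Z)"
      using Z unstraighten_slope_space[of Z "proj_matrix W"] grassmann_reflection_matrix_graph[OF W(1)]
      by (simp add: refl_unstraighten_def refl_graph_def)
    moreover have "matrix_graph W Z \<in> Grassmannian k"
      using Z matrix_graph_in_graph_domain[OF W(1)] graph_domain_subset[OF assms] by blast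
    ultimately show "Z \<in> refl_straighten W ` (reflection_model k \<inter> ?A)"
      using inv2[of Z] by (metis IntI imageI reflection_model_eq)
  qed
  moreover have "subspace ?L" "dim ?L = k * (CARD('n) - k)"
    using subspace_slope_space dim_slope_space[OF W(1)] W(2) by auto
  ultimately show ?thesis
    unfolding slice_charts_def
    using open_refl_domain open_img inj smooth_on_refl_straighten by blast
qed

section \<open>The diffeomorphism and its inverse\<close>

text \<open>In charts the map is a slice chart after \<open>refl_graph\<close>, and its inverse is
  \<open>refl_slope\<close> after the inverse of a slice chart; these composites extend smoothly to
  open sets.\<close>

lemma diffeomorphism_grassmann_reflection:
  "diffeomorphism (Grassmann_manifold k :: ((real^'n) set, real^'n^'n) charted_space)
    (embedded_submanifold (k * (CARD('n) - k)) (reflection_model k)) grassmann_reflection"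
  (is "diffeomorphism ?G ?R _")
  unfolding diffeomorphism_def
proof (intro conjI)
  let ?S = "reflection_model k :: (real^'n^'n) set"
  have carrier: "mcarrier ?G = Grassmannian k" "mcarrier ?R = ?S"
    by (simp_all add: Grassmann_manifold_def topspace_Grassmann_topology embedded_submanifold_def)
  have inj: "inj_on grassmann_reflection (Grassmannian k :: (real^'n) set set)"
    by (rule inj_on_grassmann_reflection)
  show "smooth_manifold ?G" by (rule smooth_manifold_Grassmann)
  show "smooth_manifold ?R"
  proof (rule smooth_manifold_embedded_submanifold)
    fix Q assume "Q \<in> ?S"
    then obtain W where W: "W \<in> Grassmannian k" "Q = grassmann_reflection W"
      by (auto simp: reflection_model_eq)
    then have "Q \<in> refl_domain W"
      using grassmann_reflection_in_refl_domain centre_in_graph_domain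
      by (metis (mono_tags, lifting) Grassmannian_def mem_Collect_eq)
    with \<open>Q \<in> ?S\<close> refl_straighten_slice_chart[OF W(1)]
    show "\<exists>(V, \<psi>)\<in>slice_charts (k * (CARD('n) - k)) ?S. Q \<in> V" by blast
  qed
  show "bij_betw grassmann_reflection (mcarrier ?G) (mcarrier ?R)"
    unfolding carrier bij_betw_def using inj reflection_model_eq by blast
  have hom: "homeomorphic_map (mtop ?G) (mtop ?R) grassmann_reflection"
    using homeomorphic_map_grassmann_reflection[of k]
    by (simp add: Grassmann_manifold_def embedded_submanifold_def)
  have chart: "smooth_map_on (graph_coord W ` (graph_domain W \<inter> grassmann_reflection -` V))
      (\<psi> \<circ> grassmann_reflection \<circ> inv_into (graph_domain W) (graph_coord W))"
    if W: "W \<in> Grassmannian k" and V: "(V, \<psi>) \<in> slice_charts (k * (CARD('n) - k)) ?S" for W V \<psi>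
  proof -
    obtain A where A: "V = ?S \<inter> A" "open A" "smooth_on A \<psi>"
      using V by (rule slice_chartsE) blast
    have sW: "subspace W" using W by (simp add: Grassmannian_def)
    have T: "open (refl_graph W -` A)" by (rule open_vimage_refl_graph[OF A(2)])
    show ?thesis
    proof (rule smooth_map_onI[OF T])
      show "smooth_on (refl_graph W -` A) (\<lambda>X. \<psi> (refl_graph W X))"
        by (rule smooth_on_compose[OF T A(2) _ smooth_on_refl_graph[OF T] A(3)]) auto
    qed (use A(1) in \<open>auto simp: refl_graph_graph_coord sW inv_into_f_f[OF inj_on_graph_coord]\<close>)
  qed
  then show "smooth_map ?G ?R grassmann_reflection"
    unfolding smooth_map_def
    using homeomorphic_imp_continuous_map[OF hom]
    by (auto simp: Grassmann_manifold_def embedded_submanifold_def Grassmann_charts_def)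
  let ?i = "inv_into (Grassmannian k) grassmann_reflection :: real^'n^'n \<Rightarrow> (real^'n) set"
  have "homeomorphic_map (mtop ?R) (mtop ?G) ?i"
  proof -
    obtain g where g: "homeomorphic_maps (mtop ?G) (mtop ?R) grassmann_reflection g"
      using hom homeomorphic_map_maps by blast
    \<comment> \<open>The continuous inverse is given only as some \<open>g\<close>; injectivity
      identifies it with \<open>inv_into\<close> on the model.\<close>
    have "g Q = ?i Q" if "Q \<in> ?S" for Q
      using g that inj unfolding homeomorphic_maps_def carrier continuous_map_def
      by (metis PiE inv_into_f_eq)
    then show ?thesis
      using g homeomorphic_maps_imp_map[OF homeomorphic_maps_sym[THEN iffD1, OF g]]
        homeomorphic_map_eq carrier by metis
  qed
  then have cont: "continuous_map (mtop ?R) (mtop ?G) ?i"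
    by (rule homeomorphic_imp_continuous_map)
  have "smooth_map_on (\<psi> ` (V \<inter> ?i -` graph_domain W)) (graph_coord W \<circ> ?i \<circ> inv_into V \<psi>)"
    if W: "W \<in> Grassmannian k" and V: "(V, \<psi>) \<in> slice_charts (k * (CARD('n) - k)) ?S" for W V \<psi>
  proof -
    obtain A where A: "V = ?S \<inter> A" "open A" "open (\<psi> ` A)" "inj_on \<psi> A"
      "smooth_on (\<psi> ` A) (inv_into A \<psi>)"
      using V by (rule slice_chartsE) blast
    have sW: "subspace W" using W by (simp add: Grassmannian_def)
    \<comment> \<open>The open set of slice coordinates whose matrices admit a slope relative to
      W.\<close>
    define T where "T = \<psi> ` A \<inter> inv_into A \<psi> -` refl_domain W"
    have T: "open T"
      unfolding T_def
      using continuous_open_preimage[OF smooth_on_imp_continuous_on[OF A(5)] A(3) open_refl_domain] .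
    have img: "\<exists>U\<in>graph_domain W. ?i (inv_into V \<psi> y) = U \<and> inv_into A \<psi> y = grassmann_reflection U
        \<and> y \<in> \<psi> ` A"
      if "y \<in> \<psi> ` (V \<inter> ?i -` graph_domain W)" for y
    proof -
      obtain Q where Q: "Q \<in> ?S" "Q \<in> A" "?i Q \<in> graph_domain W" "y = \<psi> Q"
        using \<open>y \<in> _\<close> A(1) by blast
      have "inv_into V \<psi> y = Q" "inv_into A \<psi> y = Q"
        using Q A(1,4) inv_into_Int[OF A(4), of y ?S] by (auto simp: inv_into_f_f)
      moreover have "grassmann_reflection (?i Q) = Q"
        using Q(1) by (simp add: reflection_model_eq f_inv_into_f)
      ultimately show ?thesis using Q by auto
    qed
    show ?thesis
    proof (rule smooth_map_onI[OF T])
      show "smooth_on T (\<lambda>y. refl_slope W (inv_into A \<psi> y))"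
        by (rule smooth_on_compose[OF T open_refl_domain _ smooth_on_subset[OF A(5)]
              smooth_on_refl_slope]) (auto simp: T_def)
      show "\<psi> ` (V \<inter> ?i -` graph_domain W) \<subseteq> T"
        using img grassmann_reflection_in_refl_domain[OF _ sW] by (fastforce simp: T_def)
      show "refl_slope W (inv_into A \<psi> y) = (graph_coord W \<circ> ?i \<circ> inv_into V \<psi>) y"
        if "y \<in> \<psi> ` (V \<inter> ?i -` graph_domain W)" for y
        using img[OF that] refl_slope_grassmann_reflection[OF _ sW] by auto
    qed
  qed
  with cont show "smooth_map ?R ?G (inv_into (mcarrier ?G) grassmann_reflection)"
    unfolding smooth_map_def carrier
    by (auto simp: Grassmann_manifold_def embedded_submanifold_def Grassmann_charts_def)
qed

section \<open>Orthonormal bases of the 1-eigenspace\<close>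

lemma range_matrix_vector_mult: "range ((*v) Y) = span (columns Y)"
  for Y :: "real^'k^'n"
proof
  show "range ((*v) Y) \<subseteq> span (columns Y)"
    using matrix_vector_mult_in_columnspace by blast
  have "columns Y \<subseteq> range ((*v) Y)"
    by (simp add: columns_image_basis image_mono)
  then show "span (columns Y) \<subseteq> range ((*v) Y)"
    by (rule span_minimal) (simp add: linear_subspace_image)
qed

text \<open>An orthonormal basis of W has as many elements as the index type \<open>'k\<close>, so a
  bijection arranges it as the columns of a matrix.\<close>

lemma ex_eigenbasis_matrix:
  fixes W :: "(real^'n) set"
  assumes "subspace W" "dim W = CARD('k::finite)"
  shows "\<exists>Y :: real^'k^'n. eigenbasis_matrix (grassmann_reflection W) Y"
proof -
  obtain B where B: "finite B" "card B = dim W" "span B = W"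
    "\<And>b c. b \<in> B \<Longrightarrow> c \<in> B \<Longrightarrow> b \<bullet> c = (if b = c then 1 else 0)"
    using orthonormal_basis[OF assms(1)] by metis
  obtain h :: "'k \<Rightarrow> real^'n" where h: "bij_betw h UNIV B"
    using B(1,2) assms(2) finite_same_card_bij[of "UNIV :: 'k set" B] by auto
  define Y :: "real^'k^'n" where "Y = (\<chi> i j. h j $ i)"
  have col: "column j Y = h j" for j
    by (simp add: Y_def column_def vec_eq_iff)
  have "columns Y = B"
    using h by (auto simp: columns_def col bij_betw_def)
  moreover have "h i \<bullet> h j = (if i = j then 1 else 0)" for i j
    using B(4)[of "h i" "h j"] h by (auto simp: bij_betw_def inj_eq)
  ultimately have "eigenbasis_matrix (grassmann_reflection W) Y"
    using B(3) assms(1) by (simp add: eigenbasis_matrix_def col grassmann_reflection_fixes_iff)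
  then show ?thesis ..
qed

theorem proposition2p1:
  fixes k :: nat
  assumes "k \<in> {1..CARD('n::finite)}" and "CARD('k::finite) = k"
  shows "diffeomorphism
           (Grassmann_manifold k :: ((real^'n) set, real^'n^'n) charted_space)
           (embedded_submanifold (k * (CARD('n) - k)) (reflection_model k))
           grassmann_reflection \<and>
         (\<forall>Q \<in> (reflection_model k :: (real^'n^'n) set).
            (\<exists>Y :: real^'k^'n. eigenbasis_matrix Q Y) \<and>
            (\<forall>Y :: real^'k^'n. eigenbasis_matrix Q Y \<longrightarrow>
               inv_into (Grassmannian k) grassmann_reflection Q = range (\<lambda>c. Y *v c)))"
proof (intro conjI ballI allI impI)
  show "diffeomorphism
      (Grassmann_manifold k :: ((real^'n) set, real^'n^'n) charted_space)
      (embedded_submanifold (k * (CARD('n) - k)) (reflection_model k)) grassmann_reflection"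
    by (rule diffeomorphism_grassmann_reflection)
  fix Q :: "real^'n^'n" assume "Q \<in> reflection_model k"
  then obtain W where W: "W \<in> Grassmannian k" "Q = grassmann_reflection W"
    by (auto simp: reflection_model_eq)
  then have sub: "subspace W" "dim W = CARD('k)" using assms by (auto simp: Grassmannian_def)
  then show "\<exists>Y :: real^'k^'n. eigenbasis_matrix Q Y"
    unfolding W(2) by (rule ex_eigenbasis_matrix)
  fix Y :: "real^'k^'n" assume "eigenbasis_matrix Q Y"
  \<comment> \<open>The range is the column span, i.e. the fixed space of Q, which is W.\<close>
  then have "range ((*v) Y) = W"
    using sub(1) W(2)
    by (simp add: eigenbasis_matrix_def range_matrix_vector_mult grassmann_reflection_fixes_iff)
  then show "inv_into (Grassmannian k) grassmann_reflection Q = range (\<lambda>c. Y *v c)"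
    using W by (simp add: inv_into_f_f[OF inj_on_grassmann_reflection])
qed

end
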